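(* Within the Fourier-mode class of forcings (defined in the context), the following holds. (1) The smallest saturating system containing the constant profile ($\varepsilon=1$) has seven real profiles: the constant together with the sine–cosine pairs associated with three wave vectors forming a unimodular basis of $\mathbb Z^3$. In particular, one may take $1,\ \cos x_i,\ \sin x_i$, $1\le i\le3$. (2) Without the constant profile ($\varepsilon=0$), at least four wave vectors, hence eight real profiles, are necessary for saturation. The minimum is attained by $\mathcal K=\{e_1,e_2,e_3,e_1+e_2\}$. (3) The three coordinate frequency pairs alone ($\varepsilon=0$, $\mathcal K=\{e_1,e_2,e_3\}$) fail to be saturating by an index two parity obstruction, i.e. $\Gamma_{\mathrm{pair}}$ has index two in $\mathbb Z^3$.
   Context: $\mathbb T^3=(\mathbb R/2\pi\mathbb Z)^3$; $e_1,e_2,e_3$ is the standard basis of $\mathbb Z^3$. Fourier-mode class: $\mathcal K=\{k_1,\dots,k_N\}\subset\mathbb Z^3\setminus\{0\}$, $N\ge1$, with $\mathcal K\cap(-\mathcal K)=\varnothing$, $\varepsilon\in\{0,1\}$, and the set of forcing profiles is $$\mathcal S_0=\{b_1,\dots,b_m\}=\{1:\varepsilon=1\}\cup\{\cos(k\cdot x),\sin(k\cdot x):k\in\mathcal K\}$$ (the first set being empty when $\varepsilon=0$). Thus the number of real profiles is $m=2N+\varepsilon$. Put $\mathcal A=\{\pm k:k\in\mathcal K\}\cup\{0:\varepsilon=1\}$ and $\Gamma_{\mathrm{pair}}=\operatorname{span}_{\mathbb Z}\{k+k':k,k'\in\mathcal A\}$. Saturation: $\mathcal S_{n+1}=\mathcal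 S_n\cup\{\phi b_jb_k:\phi\in\mathcal S_n,\ 1\le j,k\le m\}$, $\mathcal S_\infty=\operatorname{span}_{\mathbb R}\bigcup_{n\ge0}\mathcal S_n$. The forcing is (cubically) saturating if $\mathcal S_\infty$ is dense in the real Sobolev space $H^1(\mathbb T^3)$. *)

theory Defs
  imports "HOL-Analysis.Analysis"
begin

section \<open>The real Sobolev space on the torus\<close>

text \<open>
  A function on the torus \<open>(\<real> / 2\<pi>\<int>)\<^sup>3\<close> is a function on \<open>\<real>\<^sup>3\<close> that is \<open>2\<pi>\<close>-periodic in each
  coordinate; integrals over the torus are Lebesgue integrals over the fundamental cell.
\<close>

definition periodic :: "(real^3 \<Rightarrow> real) \<Rightarrow> bool" where
  "periodic u \<longleftrightarrow> (\<forall>x i. u (x + (2 * pi) *\<^sub>R axis i 1) = u x)"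

definition torus :: "(real^3) measure" where
  "torus = lebesgue_on (cbox 0 (\<chi> i. 2 * pi))"

definition L2_torus :: "(real^3 \<Rightarrow> real) set" where
  "L2_torus = {u. periodic u \<and> u \<in> borel_measurable torus \<and> integrable torus (\<lambda>x. (u x)\<^sup>2)}"

definition has_partial :: "(real^3 \<Rightarrow> real) \<Rightarrow> 3 \<Rightarrow> (real^3 \<Rightarrow> real) \<Rightarrow> bool" where
  "has_partial f j g \<longleftrightarrow>
     (\<forall>x. ((\<lambda>t. f (x + t *\<^sub>R axis j 1)) has_real_derivative g x) (at 0))"

text \<open>\<open>C\<^sup>\<infinity>\<close>: continuous partial derivatives of all orders.\<close>

coinductive smooth :: "(real^3 \<Rightarrow> real) \<Rightarrow> bool" where
  "continuous_on UNIV f \<Longrightarrow> \<forall>j. \<exists>g. has_partial f j g \<and> smooth g \<Longrightarrow> smooth f"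

definition weak_partial :: "(real^3 \<Rightarrow> real) \<Rightarrow> 3 \<Rightarrow> (real^3 \<Rightarrow> real) \<Rightarrow> bool" where
  "weak_partial u j g \<longleftrightarrow> g \<in> L2_torus \<and>
     (\<forall>\<psi> \<psi>'. periodic \<psi> \<and> smooth \<psi> \<and> has_partial \<psi> j \<psi>' \<longrightarrow>
        (\<integral>x. u x * \<psi>' x \<partial>torus) = - (\<integral>x. g x * \<psi> x \<partial>torus))"

definition H1_torus :: "(real^3 \<Rightarrow> real) set" where
  "H1_torus = {u \<in> L2_torus. \<forall>j. \<exists>g. weak_partial u j g}"

text \<open>
  The weak derivatives are unique up to null sets, so the choice made by \<open>SOME\<close> does not
  affect the value for \<open>u \<in> H1_torus\<close>. Elements of \<open>H1_torus\<close> are functions, not classes modulo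
  null sets; \<open>H1_norm\<close> is a seminorm on them.
\<close>

definition H1_norm :: "(real^3 \<Rightarrow> real) \<Rightarrow> real" where
  "H1_norm u = sqrt ((\<integral>x. (u x)\<^sup>2 \<partial>torus)
     + (\<Sum>j\<in>UNIV. \<integral>x. ((SOME g. weak_partial u j g) x)\<^sup>2 \<partial>torus))"

definition dense_in_H1 :: "(real^3 \<Rightarrow> real) set \<Rightarrow> bool" where
  "dense_in_H1 A \<longleftrightarrow> A \<subseteq> H1_torus \<and>
     (\<forall>u\<in>H1_torus. \<forall>\<delta>>0. \<exists>\<phi>\<in>A. H1_norm (\<lambda>x. u x - \<phi> x) < \<delta>)"

section \<open>Fourier-mode forcings and saturation\<close>

text \<open>A forcing is given by the set \<open>K\<close> of wave vectors and \<open>\<epsilon> \<in> {0,1}\<close>.\<close>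

definition fourier_mode_class :: "(int^3) set \<Rightarrow> nat \<Rightarrow> bool" where
  "fourier_mode_class K \<epsilon> \<longleftrightarrow>
     finite K \<and> K \<noteq> {} \<and> 0 \<notin> K \<and> K \<inter> uminus ` K = {} \<and> \<epsilon> \<in> {0, 1}"

definition phase :: "int^3 \<Rightarrow> real^3 \<Rightarrow> real" where
  "phase k x = (\<Sum>i\<in>UNIV. of_int (k $ i) * x $ i)"

definition profiles :: "(int^3) set \<Rightarrow> nat \<Rightarrow> (real^3 \<Rightarrow> real) set" where
  "profiles K \<epsilon> = (if \<epsilon> = 1 then {\<lambda>x. 1} else {})
     \<union> (\<Union>k\<in>K. {\<lambda>x. cos (phase k x), \<lambda>x. sin (phase k x)})"

primrec saturation :: "(int^3) set \<Rightarrow> nat \<Rightarrow> nat \<Rightarrow> (real^3 \<Rightarrow> real) set" where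
  "saturation K \<epsilon> 0 = profiles K \<epsilon>"
| "saturation K \<epsilon> (Suc n) = saturation K \<epsilon> n \<union>
     {\<lambda>x. \<phi> x * b x * b' x | \<phi> b b'.
        \<phi> \<in> saturation K \<epsilon> n \<and> b \<in> profiles K \<epsilon> \<and> b' \<in> profiles K \<epsilon>}"

text \<open>Written out because the type of real-valued functions is not an instance of \<open>real_vector\<close>.\<close>

definition fun_span :: "('a \<Rightarrow> real) set \<Rightarrow> ('a \<Rightarrow> real) set" where
  "fun_span A = {\<lambda>x. \<Sum>f\<in>F. c f * f x | F c. finite F \<and> F \<subseteq> A}"

definition saturation_limit :: "(int^3) set \<Rightarrow> nat \<Rightarrow> (real^3 \<Rightarrow> real) set" where
  "saturation_limit K \<epsilon> = fun_span (\<Union>n. saturation K \<epsilon> n)"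

definition saturating :: "(int^3) set \<Rightarrow> nat \<Rightarrow> bool" where
  "saturating K \<epsilon> \<longleftrightarrow> dense_in_H1 (saturation_limit K \<epsilon>)"

section \<open>Lattices\<close>

interpretation int_vec: module "(*s) :: int \<Rightarrow> int^'n \<Rightarrow> int^'n"
  by unfold_locales (vector algebra_simps)+

definition modes :: "(int^3) set \<Rightarrow> nat \<Rightarrow> (int^3) set" where
  "modes K \<epsilon> = K \<union> uminus ` K \<union> (if \<epsilon> = 1 then {0} else {})"

definition Gamma_pair :: "(int^3) set \<Rightarrow> nat \<Rightarrow> (int^3) set" where
  "Gamma_pair K \<epsilon> = int_vec.span {k + k' | k k'. k \<in> modes K \<epsilon> \<and> k' \<in> modes K \<epsilon>}"

text \<open>The number of cosets; it is \<open>0\<close> when there are infinitely many.\<close>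

definition lattice_index :: "(int^3) set \<Rightarrow> nat" where
  "lattice_index H = card (UNIV // {(x, y). y - x \<in> H})"

definition unimodular_basis :: "(int^3) set \<Rightarrow> bool" where
  "unimodular_basis K \<longleftrightarrow>
     (\<exists>a b c. K = {a, b, c} \<and> \<bar>det (vector [a, b, c] :: int^3^3)\<bar> = 1)"

abbreviation e\<^sub>1 :: "int^3" where "e\<^sub>1 \<equiv> axis 1 1"
abbreviation e\<^sub>2 :: "int^3" where "e\<^sub>2 \<equiv> axis 2 1"
abbreviation e\<^sub>3 :: "int^3" where "e\<^sub>3 \<equiv> axis 3 1"

end

theory Submission
  imports Defs
begin

text \<open>
Multiplying a trigonometric polynomial by two profiles adds or subtracts two modes to each of its
frequencies. Hence \<open>saturation_limit\<close> is the span of all waves whose frequency is a sum of an odd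
number of modes (\<open>saturation_limit_eq_trig\<close>), and whether a forcing saturates is a question about
\<open>\<int>\<^sup>3\<close> alone: it does if and only if the odd sums of modes exhaust \<open>\<int>\<^sup>3\<close>
(\<open>saturating_iff_odd_sums\<close>). If a frequency \<open>n\<close> is missed, then \<open>cos (n \<bullet> x)\<close> is \<open>L\<^sup>2\<close>-orthogonal to
the whole span and stays at a positive distance from it; if none is missed, the span is the space of
all trigonometric polynomials, which is dense in \<open>H\<^sup>1\<close> (\<open>trig_dense_H1\<close>).

The density in \<open>H\<^sup>1\<close> reduces to the density in \<open>L\<^sup>2\<close>. Fourier truncation to a finite
symmetric set of frequencies is the \<open>L\<^sup>2\<close>-orthogonal projection, hence a best approximation, and it
commutes with weak derivatives; so one truncation approximates \<open>u\<close> and its weak derivatives at the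
same time. The density in \<open>L\<^sup>2\<close> is the Stone--Weierstrass theorem on the torus, embedded as a
product of three unit circles, applied to continuous functions that vanish on the boundary of the
cell. The orthogonality of the waves and integration by parts both come from one fact, that partial
derivatives of periodic functions have integral zero (\<open>torus_integral_partial\<close>).

The arithmetic is reduction modulo 2. An odd sum of modes is an integer combination of \<open>K\<close>, with an
odd sum of coefficients if the mode \<open>0\<close> is absent; modulo 2 it is the sum of a subset of \<open>K\<close>, of odd
cardinality if the mode \<open>0\<close> is absent. There are \<open>2 ^ card K\<close> subsets and \<open>2 ^ (card K - 1)\<close> of odd
cardinality, and they must produce all eight parity classes of \<open>\<int>\<^sup>3\<close>; so saturation needs three
wave vectors with the constant profile and four without it (\<open>saturating_card_lower\<close>). If exactly
three vectors generate \<open>\<int>\<^sup>3\<close>, they form a unimodular matrix, because the matrix has an integer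
inverse. Conversely, as soon as three modes add up to \<open>0\<close>, the parity restriction disappears and a
unimodular triple of modes suffices (\<open>saturating_if_zero_triple\<close>); this applies to \<open>0 + 0 + 0 = 0\<close> when
the constant is present and to \<open>e\<^sub>1 + e\<^sub>2 - (e\<^sub>1 + e\<^sub>2) = 0\<close> for the minimal example without it.
\<close>

section \<open>Finite real combinations of functions\<close>

lemma fun_span_base: "f \<in> A \<Longrightarrow> f \<in> fun_span A"
  unfolding fun_span_def
  by (rule CollectI, rule exI[of _ "{f}"], rule exI[of _ "\<lambda>_. 1"]) auto

lemma fun_span_zero: "(\<lambda>x. 0) \<in> fun_span A"
  unfolding fun_span_def
  by (rule CollectI, rule exI[of _ "{}"], rule exI[of _ "\<lambda>_. 1"]) auto

lemma fun_span_scale: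
  assumes "f \<in> fun_span A" shows "(\<lambda>x. a * f x) \<in> fun_span A"
proof -
  obtain F c where "finite F" "F \<subseteq> A" "f = (\<lambda>x. \<Sum>g\<in>F. c g * g x)"
    using assms unfolding fun_span_def by blast
  then show ?thesis
    unfolding fun_span_def
    by (intro CollectI exI[of _ F] exI[of _ "\<lambda>g. a * c g"]) (simp add: sum_distrib_left mult.assoc)
qed

lemma fun_span_add:
  assumes "f \<in> fun_span A" "g \<in> fun_span A" shows "(\<lambda>x. f x + g x) \<in> fun_span A"
proof -
  obtain F c where F: "finite F" "F \<subseteq> A" "f = (\<lambda>x. \<Sum>h\<in>F. c h * h x)"
    using assms unfolding fun_span_def by blast
  obtain G d where G: "finite G" "G \<subseteq> A" "g = (\<lambda>x. \<Sum>h\<in>G. d h * h x)"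
    using assms unfolding fun_span_def by blast
  let ?c = "\<lambda>h. if h \<in> F then c h else 0" and ?d = "\<lambda>h. if h \<in> G then d h else 0"
  have "f x + g x = (\<Sum>h\<in>F\<union>G. (?c h + ?d h) * h x)" for x
  proof -
    have "f x = (\<Sum>h\<in>F\<union>G. ?c h * h x)"
      unfolding F(3) by (rule sum.mono_neutral_cong_left) (use F G in auto)
    moreover have "g x = (\<Sum>h\<in>F\<union>G. ?d h * h x)"
      unfolding G(3) by (rule sum.mono_neutral_cong_left) (use F G in auto)
    ultimately show ?thesis by (simp add: sum.distrib distrib_right)
  qed
  then show ?thesis
    unfolding fun_span_def
    by (intro CollectI exI[of _ "F\<union>G"] exI[of _ "\<lambda>h. ?c h + ?d h"]) (use F G in auto)
qed

lemma fun_span_induct [consumes 1, case_names zero step]: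
  assumes "f \<in> fun_span A" and "P (\<lambda>x. 0)"
    and "\<And>a g h. g \<in> A \<Longrightarrow> h \<in> fun_span A \<Longrightarrow> P h \<Longrightarrow> P (\<lambda>x. a * g x + h x)"
  shows "P f"
proof -
  obtain F c where F: "finite F" "F \<subseteq> A" "f = (\<lambda>x. \<Sum>h\<in>F. c h * h x)"
    using assms unfolding fun_span_def by blast
  have "P (\<lambda>x. \<Sum>h\<in>F. c h * h x)"
    using F(1,2)
  proof induction
    case (insert g F)
    moreover have "(\<lambda>x. \<Sum>h\<in>F. c h * h x) \<in> fun_span A"
      unfolding fun_span_def using insert by blast
    ultimately show ?case
      using assms(3)[of g "\<lambda>x. \<Sum>h\<in>F. c h * h x" "c g"] by simp
  qed (use assms in simp)
  then show ?thesis using F by simp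
qed

lemma fun_span_minimal:
  assumes "A \<subseteq> fun_span B" shows "fun_span A \<subseteq> fun_span B"
proof
  fix f assume "f \<in> fun_span A"
  then show "f \<in> fun_span B"
    by (induction rule: fun_span_induct) (use assms in \<open>auto intro!: fun_span_zero fun_span_add fun_span_scale\<close>)
qed

lemma fun_span_mono: "A \<subseteq> B \<Longrightarrow> fun_span A \<subseteq> fun_span B"
  by (rule fun_span_minimal) (auto intro: fun_span_base)

lemma fun_span_sum:
  assumes "\<And>i. i \<in> I \<Longrightarrow> f i \<in> fun_span A"
  shows "(\<lambda>x. \<Sum>i\<in>I. f i x) \<in> fun_span A"
  using assms
  by (induction I rule: infinite_finite_induct) (auto intro!: fun_span_zero fun_span_add)

lemma fun_span_diff:
  assumes "f \<in> fun_span A" "g \<in> fun_span A" shows "(\<lambda>x. f x - g x) \<in> fun_span A"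
  using fun_span_add[OF assms(1) fun_span_scale[OF assms(2), of "-1"]] by simp

section \<open>Trigonometric polynomials\<close>

lemma phase_add: "phase (k + l) x = phase k x + phase l x"
  by (simp add: phase_def algebra_simps sum.distrib)

lemma phase_minus: "phase (- k) x = - phase k x"
  by (simp add: phase_def sum_negf)

lemma phase_diff: "phase (k - l) x = phase k x - phase l x"
  by (simp add: phase_def algebra_simps sum_subtractf)

lemma phase_zero: "phase 0 x = 0"
  by (simp add: phase_def)

lemma phase_axis: "phase (axis j 1) x = x $ j"
proof -
  have "phase (axis j 1) x = (\<Sum>i\<in>UNIV. if i = j then x $ i else 0)"
    unfolding phase_def by (rule sum.cong) (auto simp: axis_def)
  then show ?thesis by simp
qed

lemma phase_shift: "phase k (x + t *\<^sub>R axis j 1) = phase k x + t * of_int (k $ j)"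
proof -
  have "phase k (x + t *\<^sub>R axis j 1) = phase k x + (\<Sum>i\<in>UNIV. if i = j then t * of_int (k $ j) else 0)"
    unfolding phase_def sum.distrib[symmetric] by (rule sum.cong) (auto simp: axis_def algebra_simps)
  then show ?thesis by simp
qed

text \<open>
The Boolean selects the cosine or the sine, so that both can be treated by one statement.
\<close>

definition wave :: "int^3 \<Rightarrow> bool \<Rightarrow> real^3 \<Rightarrow> real" where
  "wave k s = (\<lambda>x. if s then cos (phase k x) else sin (phase k x))"

definition trig :: "(int^3) set \<Rightarrow> (real^3 \<Rightarrow> real) set" where
  "trig F = fun_span (\<Union>k\<in>F. range (wave k))"

lemma wave_in_trig: "k \<in> F \<Longrightarrow> wave k s \<in> trig F"
  unfolding trig_def by (rule fun_span_base) auto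

lemma trig_mono: "F \<subseteq> G \<Longrightarrow> trig F \<subseteq> trig G"
  unfolding trig_def by (rule fun_span_mono) auto

lemma trig_induct [consumes 1, case_names zero step]:
  assumes "p \<in> trig F" and "P (\<lambda>x. 0)"
    and "\<And>a k s q. k \<in> F \<Longrightarrow> q \<in> trig F \<Longrightarrow> P q \<Longrightarrow> P (\<lambda>x. a * wave k s x + q x)"
  shows "P p"
  using assms(1) unfolding trig_def
  by (induction rule: fun_span_induct) (use assms(2,3) in \<open>auto simp: trig_def\<close>)

lemma trig_const: "(\<lambda>x. c) \<in> trig UNIV"
proof -
  have "wave 0 True = (\<lambda>x. 1)" by (simp add: wave_def phase_zero)
  then show ?thesis
    using fun_span_scale[of "wave 0 True" _ c] wave_in_trig[of 0 UNIV True] by (simp add: trig_def)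
qed

lemma trig_finite_support:
  assumes "p \<in> trig UNIV" obtains F where "finite F" "p \<in> trig F"
proof -
  have "\<exists>F. finite F \<and> p \<in> trig F"
    using assms
  proof (induction rule: trig_induct)
    case zero then show ?case by (intro exI[of _ "{}"]) (simp add: trig_def fun_span_zero)
  next
    case (step a k s q)
    then obtain F where F: "finite F" "q \<in> trig F" by blast
    have "(\<lambda>x. a * wave k s x + q x) \<in> trig (insert k F)"
      using wave_in_trig[of k "insert k F" s] F trig_mono[of F "insert k F"]
      unfolding trig_def by (intro fun_span_add fun_span_scale) auto
    then show ?case using F by blast
  qed
  then show ?thesis using that by blast
qed

lemma wave_mult:
  "wave k s x * wave l t x =
    (if s then (if t then (wave (k + l) True x + wave (k - l) True x) / 2
                     else (wave (k + l) False x - wave (k - l) False x) / 2)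
     else (if t then (wave (k + l) False x + wave (k - l) False x) / 2
           else (wave (k - l) True x - wave (k + l) True x) / 2))"
  by (simp add: wave_def phase_add phase_diff cos_add cos_diff sin_add sin_diff)

text \<open>
The form of the product-to-sum formulas used below: only the two frequencies matter, and both waves on
the right are of the same kind.
\<close>

lemma wave_mult_decomp:
  obtains a b r where "\<And>x. wave k s x * wave l t x = a * wave (k + l) r x + b * wave (k - l) r x"
  by (rule that[of "if s \<or> t then 1/2 else -1/2" "s = t" "if s \<and> \<not> t then -1/2 else 1/2"])
     (auto simp: wave_mult field_simps)

lemma trig_mult_wave:
  assumes "p \<in> trig F"
  shows "(\<lambda>x. p x * wave l t x) \<in> trig ((\<lambda>k. k + l) ` F \<union> (\<lambda>k. k - l) ` F)"
  using assms
proof (induction rule: trig_induct)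
  case zero
  then show ?case by (simp add: trig_def fun_span_zero)
next
  case (step a k s q)
  let ?G = "(\<lambda>k. k + l) ` F \<union> (\<lambda>k. k - l) ` F"
  obtain b c r where e: "wave k s x * wave l t x = b * wave (k + l) r x + c * wave (k - l) r x" for x
    using wave_mult_decomp[of k s l t] by metis
  have "wave (k + l) r \<in> trig ?G" "wave (k - l) r \<in> trig ?G"
    using step(1) by (auto intro!: wave_in_trig)
  then have "(\<lambda>x. a * (b * wave (k + l) r x + c * wave (k - l) r x) + q x * wave l t x) \<in> trig ?G"
    using step unfolding trig_def by (intro fun_span_add fun_span_scale) auto
  then show ?case by (simp add: e[symmetric] algebra_simps)
qed

lemma trig_mult:
  assumes "p \<in> trig UNIV" "q \<in> trig UNIV" shows "(\<lambda>x. p x * q x) \<in> trig UNIV"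
  using assms(2)
proof (induction rule: trig_induct)
  case zero
  then show ?case by (simp add: trig_const)
next
  case (step a l t q)
  have "(\<lambda>x. p x * wave l t x) \<in> trig UNIV"
    using trig_mult_wave[OF assms(1)] by (rule trig_mono[THEN subsetD, rotated]) simp
  then have "(\<lambda>x. a * (p x * wave l t x) + p x * q x) \<in> trig UNIV"
    using step unfolding trig_def by (intro fun_span_add fun_span_scale) auto
  then show ?case by (simp add: algebra_simps)
qed

section \<open>Partial derivatives and smoothness\<close>

lemma has_partial_unique: "has_partial f j g \<Longrightarrow> has_partial f j h \<Longrightarrow> g = h"
  unfolding has_partial_def by (blast intro: DERIV_unique)

lemma has_partial_wave:
  "has_partial (wave k s) j (\<lambda>x. (if s then - 1 else 1) * of_int (k $ j) * wave k (\<not> s) x)"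
  unfolding has_partial_def wave_def phase_shift
  by (auto intro!: derivative_eq_intros)

lemma has_partial_add:
  assumes "has_partial f j g" "has_partial f' j g'"
  shows "has_partial (\<lambda>x. f x + f' x) j (\<lambda>x. g x + g' x)"
  using assms unfolding has_partial_def by (auto intro!: derivative_eq_intros)

lemma has_partial_cmult:
  assumes "has_partial f j g"
  shows "has_partial (\<lambda>x. a * f x) j (\<lambda>x. a * g x)"
  using assms unfolding has_partial_def by (auto intro!: derivative_eq_intros)

lemma has_partial_mult:
  assumes "has_partial f j g" "has_partial f' j g'"
  shows "has_partial (\<lambda>x. f x * f' x) j (\<lambda>x. g x * f' x + f x * g' x)"
  using assms unfolding has_partial_def by (auto intro!: derivative_eq_intros)

lemma continuous_on_phase: "continuous_on S (phase k)"
  unfolding phase_def by (intro continuous_intros)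

lemma continuous_on_wave: "continuous_on S (wave k s)"
  unfolding wave_def by (cases s) (auto intro!: continuous_intros continuous_on_phase)

lemma trig_continuous: "p \<in> trig F \<Longrightarrow> continuous_on S p"
  by (induction rule: trig_induct) (auto intro!: continuous_intros continuous_on_wave)

lemma trig_has_partial:
  assumes "p \<in> trig F" shows "\<exists>q\<in>trig F. has_partial p j q"
  using assms
proof (induction rule: trig_induct)
  case zero
  then show ?case
    by (intro bexI[of _ "\<lambda>x. 0"]) (auto simp: has_partial_def trig_def fun_span_zero)
next
  case (step a k s p)
  then obtain q where q: "q \<in> trig F" "has_partial p j q" by blast
  let ?r = "\<lambda>x. a * ((if s then - 1 else 1) * of_int (k $ j) * wave k (\<not> s) x) + q x"
  have "?r \<in> trig F"
    using wave_in_trig[of k F "\<not> s"] q step(1) unfolding trig_def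
    by (intro fun_span_add fun_span_scale) auto
  moreover have "has_partial (\<lambda>x. a * wave k s x + p x) j ?r"
    by (intro has_partial_add has_partial_cmult has_partial_wave q)
  ultimately show ?case by blast
qed

text \<open>
Trigonometric polynomials are closed under partial derivatives, so they form a coinduction
invariant for smoothness.
\<close>

lemma trig_smooth: "p \<in> trig F \<Longrightarrow> smooth p"
proof (coinduction arbitrary: p rule: smooth.coinduct)
  case smooth
  then show ?case using trig_continuous trig_has_partial by blast
qed

lemma smooth_continuous: "smooth f \<Longrightarrow> continuous_on S f"
  by (erule smooth.cases) (auto intro: continuous_on_subset)

lemma smooth_partial_continuous:
  assumes "smooth f" "has_partial f j g" shows "continuous_on S g"
proof -
  obtain h where "has_partial f j h" "smooth h" using assms(1) by (rule smooth.cases) blast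
  with assms(2) show ?thesis using has_partial_unique smooth_continuous by blast
qed

lemma periodic_wave: "periodic (wave k s)"
proof -
  have "cos (a + 2 * pi * of_int n) = cos a" "sin (a + 2 * pi * of_int n) = sin a" for a n
    by (simp_all add: cos_add sin_add cos_int_2pin sin_int_2pin)
  then show ?thesis unfolding periodic_def phase_shift wave_def by simp
qed

lemma periodic_add: "periodic f \<Longrightarrow> periodic g \<Longrightarrow> periodic (\<lambda>x. f x + g x)"
  and periodic_mult: "periodic f \<Longrightarrow> periodic g \<Longrightarrow> periodic (\<lambda>x. f x * g x)"
  and periodic_const: "periodic (\<lambda>x. a)"
  by (simp_all add: periodic_def)

lemma trig_periodic: "p \<in> trig F \<Longrightarrow> periodic p"
  by (induction rule: trig_induct) (auto intro!: periodic_add periodic_mult periodic_const periodic_wave)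

lemma periodic_partial:
  assumes "periodic f" "has_partial f j g" shows "periodic g"
  unfolding periodic_def
proof (intro allI)
  fix x i
  have "f (x + (2 * pi) *\<^sub>R axis i 1 + t *\<^sub>R axis j 1) = f (x + t *\<^sub>R axis j 1)" for t
    using assms(1) unfolding periodic_def by (metis add.commute add.left_commute)
  moreover have "((\<lambda>t. f (x + (2 * pi) *\<^sub>R axis i 1 + t *\<^sub>R axis j 1))
      has_real_derivative g (x + (2 * pi) *\<^sub>R axis i 1)) (at 0)"
    using assms(2) unfolding has_partial_def by blast
  ultimately have "((\<lambda>t. f (x + t *\<^sub>R axis j 1))
      has_real_derivative g (x + (2 * pi) *\<^sub>R axis i 1)) (at 0)"
    by simp
  then show "g (x + (2 * pi) *\<^sub>R axis i 1) = g x"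
    using assms(2) unfolding has_partial_def by (blast intro: DERIV_unique)
qed

section \<open>Integration over the torus\<close>

abbreviation cell :: "(real^3) set" where
  "cell \<equiv> cbox 0 (\<chi> i. 2 * pi)"

lemma space_torus: "space torus = cell"
  by (simp add: torus_def)

lemma continuous_torus_measurable:
  fixes f :: "real^3 \<Rightarrow> real"
  assumes "continuous_on UNIV f" shows "f \<in> borel_measurable torus"
  unfolding torus_def
  by (rule continuous_imp_measurable_on_sets_lebesgue) (use assms in \<open>auto intro: continuous_on_subset\<close>)

lemma continuous_torus_integrable:
  fixes f :: "real^3 \<Rightarrow> real"
  assumes "continuous_on UNIV f" shows "integrable torus f"
  unfolding torus_def
  by (rule continuous_imp_integrable) (use assms in \<open>auto intro: continuous_on_subset\<close>)

lemma continuous_torus_integral: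
  fixes f :: "real^3 \<Rightarrow> real"
  assumes "continuous_on UNIV f" shows "(\<integral>x. f x \<partial>torus) = integral cell f"
  using continuous_torus_integrable[OF assms] unfolding torus_def
  by (rule lebesgue_integral_eq_integral) simp

text \<open>
The slab \<open>2 * pi \<le> x $ j \<le> 2 * pi + t\<close> of the shifted cell is a period translate of the slab
\<open>0 \<le> x $ j \<le> t\<close>, which is the part of the cell that the shifted cell misses.
\<close>

lemma torus_integral_shift:
  assumes f: "continuous_on UNIV f" "periodic f" and t: "0 \<le> t" "t \<le> 2 * pi"
  shows "(\<integral>x. f (x + t *\<^sub>R axis j 1) \<partial>torus) = (\<integral>x. f x \<partial>torus)"
proof -
  define slab where "slab p q = (cbox (\<chi> i. if i = j then p else 0)
      (\<chi> i. if i = j then q else 2 * pi) :: (real^3) set)" for p q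
  have mem: "x \<in> slab p q \<longleftrightarrow> p \<le> x $ j \<and> x $ j \<le> q \<and> (\<forall>i. i \<noteq> j \<longrightarrow> 0 \<le> x $ i \<and> x $ i \<le> 2 * pi)"
    for x p q
  proof -
    have all: "(\<forall>i. Q i) \<longleftrightarrow> Q j \<and> (\<forall>i. i \<noteq> j \<longrightarrow> Q i)" for Q :: "3 \<Rightarrow> bool"
      by (rule iffI, blast, rule allI, case_tac "i = j", simp_all)
    show ?thesis
      unfolding slab_def mem_box_cart vec_lambda_beta by (subst all) auto
  qed
  have int: "f integrable_on slab p q" for p q
    unfolding slab_def by (rule integrable_continuous) (use f in \<open>auto intro: continuous_on_subset\<close>)
  have split: "integral (slab p r) f = integral (slab p q) f + integral (slab q r) f"
    if "p \<le> q" "q \<le> r" for p q r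
  proof -
    have 1: "slab p r \<inter> {x. x \<bullet> axis j 1 \<le> q} = slab p q"
      using that by (auto simp: mem inner_axis)
    have 2: "slab p r \<inter> {x. x \<bullet> axis j 1 \<ge> q} = slab q r"
      using that by (auto simp: mem inner_axis)
    show ?thesis
      using integral_split[of f _ _ "axis j 1" q] int[of p r] 1 2
      by (auto simp: slab_def axis_in_Basis_iff)
  qed
  have shift: "integral (slab p q) (\<lambda>x. f (x + s *\<^sub>R axis j 1)) = integral (slab (p + s) (q + s)) f"
    for p q s
  proof -
    have "(\<chi> i. if i = j then a else b) + s *\<^sub>R axis j 1 = (\<chi> i. if i = j then a + s else b)"
      for a b :: real
      by (simp add: vec_eq_iff axis_def)
    then show ?thesis
      using integral_shift_cbox_plus[of "\<chi> i. if i = j then p else 0"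
          "\<chi> i. if i = j then q else 2 * pi" f "s *\<^sub>R axis j 1"]
      by (simp add: slab_def o_def add.commute)
  qed
  have cell: "cell = slab 0 (2 * pi)"
    by (simp add: slab_def zero_vec_def)
  have per: "(\<lambda>x. f (x + (2 * pi) *\<^sub>R axis j 1)) = f"
    using f(2) by (simp add: periodic_def)
  have "(\<integral>x. f (x + t *\<^sub>R axis j 1) \<partial>torus) = integral cell (\<lambda>x. f (x + t *\<^sub>R axis j 1))"
    by (intro continuous_torus_integral continuous_intros continuous_on_compose2[OF f(1)]) auto
  also have "\<dots> = integral (slab t (2 * pi + t)) f"
    unfolding cell by (simp add: shift)
  also have "\<dots> = integral (slab t (2 * pi)) f + integral (slab (2 * pi) (2 * pi + t)) f"
    by (rule split) (use t in auto)
  also have "integral (slab (2 * pi) (2 * pi + t)) f = integral (slab 0 t) f"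
    using shift[of 0 t "2 * pi"] per by (simp add: add.commute)
  also have "integral (slab t (2 * pi)) f + integral (slab 0 t) f = integral cell f"
    unfolding cell using split[of 0 t "2 * pi"] t by simp
  also have "\<dots> = (\<integral>x. f x \<partial>torus)"
    by (rule continuous_torus_integral[symmetric, OF f(1)])
  finally show ?thesis .
qed

text \<open>
Translation invariance makes the integral of every difference quotient vanish, and the quotients
converge boundedly to the derivative by the mean value theorem.
\<close>

lemma torus_integral_partial:
  assumes f: "continuous_on UNIV f" "periodic f" and g: "has_partial f j g" "continuous_on UNIV g"
  shows "(\<integral>x. g x \<partial>torus) = 0"
proof -
  define h where "h n = inverse (real (Suc n))" for n
  have h: "0 < h n" "h n \<le> 1" for n
    by (auto simp: h_def inverse_le_1_iff)
  define d where "d n x = (f (x + h n *\<^sub>R axis j 1) - f x) / h n" for n x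
  have cont_shift: "continuous_on UNIV (\<lambda>x. f (x + s *\<^sub>R axis j 1))" for s
    by (intro continuous_intros continuous_on_compose2[OF f(1)]) auto
  have cont_d: "continuous_on UNIV (d n)" for n
    using h[of n] unfolding d_def by (intro continuous_intros cont_shift f) auto
  have int_d: "(\<integral>x. d n x \<partial>torus) = 0" for n
  proof -
    have "h n \<le> 2 * pi" using h(2)[of n] pi_gt3 by linarith
    then show ?thesis
      using h[of n] unfolding d_def
      by (simp add: Bochner_Integration.integral_diff continuous_torus_integrable cont_shift f torus_integral_shift)
  qed
  have "compact (g ` cbox 0 (\<chi> i. 2 * pi + 1))"
    by (intro compact_continuous_image compact_cbox) (use g in \<open>auto intro: continuous_on_subset\<close>)
  then obtain B where B: "\<bar>g y\<bar> \<le> B" if "y \<in> cbox 0 (\<chi> i. 2 * pi + 1)" for y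
    unfolding bounded_iff real_norm_def using compact_imp_bounded
    by (metis bounded_iff imageI real_norm_def)
  have deriv: "((\<lambda>s. f (x + s *\<^sub>R axis j 1)) has_real_derivative g (x + s *\<^sub>R axis j 1)) (at s)" for x s
  proof -
    have "((\<lambda>t. f (x + s *\<^sub>R axis j 1 + t *\<^sub>R axis j 1)) has_real_derivative g (x + s *\<^sub>R axis j 1)) (at 0)"
      using g unfolding has_partial_def by blast
    then show ?thesis
      using DERIV_shift[of "\<lambda>s. f (x + s *\<^sub>R axis j 1)" _ 0 s] by (simp add: algebra_simps)
  qed
  have bound: "\<bar>d n x\<bar> \<le> B" if x: "x \<in> cell" for n x
  proof -
    have "\<exists>z. 0 < z \<and> z < h n \<and> f (x + h n *\<^sub>R axis j 1) - f (x + 0 *\<^sub>R axis j 1)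
        = (h n - 0) * g (x + z *\<^sub>R axis j 1)"
      using h(1)[of n] deriv by (intro MVT2) auto
    then obtain z where z: "0 < z" "z < h n" "d n x = g (x + z *\<^sub>R axis j 1)"
      using h[of n] by (auto simp: d_def)
    have "x + z *\<^sub>R axis j 1 \<in> cbox 0 (\<chi> i. 2 * pi + 1)"
      using x z h(2)[of n] by (auto simp: mem_box_cart axis_def intro: add_mono order_trans)
    then show ?thesis using B z by simp
  qed
  have "h \<longlonglongrightarrow> 0"
    unfolding h_def by (rule LIMSEQ_inverse_real_of_nat)
  then have "filterlim h (at 0) sequentially"
    using h(1) by (intro filterlim_atI always_eventually) (auto simp: less_imp_neq[symmetric])
  moreover have "((\<lambda>s. (f (x + s *\<^sub>R axis j 1) - f x) / s) \<longlongrightarrow> g x) (at 0)" for x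
    using deriv[of x 0] by (simp add: has_field_derivative_iff)
  ultimately have lim: "(\<lambda>n. d n x) \<longlonglongrightarrow> g x" for x
    unfolding d_def by (rule filterlim_compose[rotated])
  have "(\<lambda>n. \<integral>x. d n x \<partial>torus) \<longlonglongrightarrow> (\<integral>x. g x \<partial>torus)"
  proof (rule integral_dominated_convergence[where w = "\<lambda>x. B"])
    show "integrable torus (\<lambda>x. B)"
      by (intro continuous_torus_integrable continuous_intros)
    show "AE x in torus. norm (d n x) \<le> B" for n
      using bound by (intro AE_I2) (simp add: space_torus)
  qed (use lim cont_d g in \<open>auto intro: continuous_torus_measurable\<close>)
  then show ?thesis by (simp add: int_d LIMSEQ_const_iff)
qed

section \<open>Square-integrable functions and the orthogonality of waves\<close>

definition inner_torus :: "(real^3 \<Rightarrow> real) \<Rightarrow> (real^3 \<Rightarrow> real) \<Rightarrow> real" where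
  "inner_torus u v = (\<integral>x. u x * v x \<partial>torus)"

lemma L2_mult_integrable:
  assumes "u \<in> L2_torus" "v \<in> L2_torus" shows "integrable torus (\<lambda>x. u x * v x)"
proof (rule Bochner_Integration.integrable_bound)
  show "integrable torus (\<lambda>x. (u x)\<^sup>2 + (v x)\<^sup>2)"
    using assms by (auto simp: L2_torus_def)
  show "(\<lambda>x. u x * v x) \<in> borel_measurable torus"
    using assms by (auto simp: L2_torus_def)
  have "\<bar>a * b\<bar> \<le> a\<^sup>2 + b\<^sup>2" for a b :: real
    using sum_squares_bound[of "\<bar>a\<bar>" "\<bar>b\<bar>"] abs_ge_zero[of "a * b"]
    unfolding abs_mult power2_abs by linarith
  then show "AE x in torus. norm (u x * v x) \<le> norm ((u x)\<^sup>2 + (v x)\<^sup>2)"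
    by (intro AE_I2) simp
qed

lemma L2_cmult: "u \<in> L2_torus \<Longrightarrow> (\<lambda>x. a * u x) \<in> L2_torus"
  by (auto simp: L2_torus_def power_mult_distrib periodic_def)

lemma L2_add:
  assumes "u \<in> L2_torus" "v \<in> L2_torus" shows "(\<lambda>x. u x + v x) \<in> L2_torus"
proof -
  have "integrable torus (\<lambda>x. (u x)\<^sup>2 + (v x)\<^sup>2 + 2 * (u x * v x))"
    using assms L2_mult_integrable[OF assms] by (auto simp: L2_torus_def)
  then show ?thesis
    using assms by (auto simp: L2_torus_def power2_sum periodic_def mult.assoc)
qed

lemma L2_diff:
  assumes "u \<in> L2_torus" "v \<in> L2_torus" shows "(\<lambda>x. u x - v x) \<in> L2_torus"
  using L2_add[OF assms(1) L2_cmult[OF assms(2), of "-1"]] by simp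

lemma continuous_periodic_L2: "continuous_on UNIV u \<Longrightarrow> periodic u \<Longrightarrow> u \<in> L2_torus"
  unfolding L2_torus_def
  by (auto intro!: continuous_torus_measurable continuous_torus_integrable continuous_intros)

lemma trig_L2: "p \<in> trig F \<Longrightarrow> p \<in> L2_torus"
  by (intro continuous_periodic_L2 trig_continuous trig_periodic)

lemma wave_L2: "wave k s \<in> L2_torus"
  by (rule trig_L2[of _ "{k}"]) (simp add: wave_in_trig)

lemma inner_torus_commute: "inner_torus u v = inner_torus v u"
  by (simp add: inner_torus_def mult.commute)

lemma inner_torus_add_left:
  assumes "u \<in> L2_torus" "v \<in> L2_torus" "w \<in> L2_torus"
  shows "inner_torus (\<lambda>x. u x + v x) w = inner_torus u w + inner_torus v w"
  using assms by (simp add: inner_torus_def distrib_right L2_mult_integrable)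

lemma inner_torus_diff_left:
  assumes "u \<in> L2_torus" "v \<in> L2_torus" "w \<in> L2_torus"
  shows "inner_torus (\<lambda>x. u x - v x) w = inner_torus u w - inner_torus v w"
  using assms by (simp add: inner_torus_def left_diff_distrib L2_mult_integrable)

lemma inner_torus_cmult_left: "inner_torus (\<lambda>x. a * u x) w = a * inner_torus u w"
  by (simp add: inner_torus_def mult.assoc)

lemma inner_torus_add_right:
  assumes "u \<in> L2_torus" "v \<in> L2_torus" "w \<in> L2_torus"
  shows "inner_torus w (\<lambda>x. u x + v x) = inner_torus w u + inner_torus w v"
  using inner_torus_add_left[OF assms] by (simp add: inner_torus_commute)

lemma inner_torus_diff_right:
  assumes "u \<in> L2_torus" "v \<in> L2_torus" "w \<in> L2_torus"
  shows "inner_torus w (\<lambda>x. u x - v x) = inner_torus w u - inner_torus w v"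
  using inner_torus_diff_left[OF assms] by (simp add: inner_torus_commute)

lemma inner_torus_cmult_right: "inner_torus w (\<lambda>x. a * u x) = a * inner_torus w u"
  using inner_torus_cmult_left by (simp add: inner_torus_commute)

lemma inner_torus_self: "inner_torus u u = (\<integral>x. (u x)\<^sup>2 \<partial>torus)"
  by (simp add: inner_torus_def power2_eq_square)

lemma inner_torus_self_nonneg: "0 \<le> inner_torus u u"
  by (simp add: inner_torus_self)

lemma inner_torus_sum_left:
  assumes "\<And>i. i \<in> I \<Longrightarrow> u i \<in> L2_torus" "w \<in> L2_torus"
  shows "inner_torus (\<lambda>x. \<Sum>i\<in>I. u i x) w = (\<Sum>i\<in>I. inner_torus (u i) w)"
  unfolding inner_torus_def sum_distrib_right
  by (rule Bochner_Integration.integral_sum) (use assms L2_mult_integrable in auto)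

lemma pythagoras_torus:
  assumes "u \<in> L2_torus" "v \<in> L2_torus" "inner_torus u v = 0"
  shows "inner_torus (\<lambda>x. u x + v x) (\<lambda>x. u x + v x) = inner_torus u u + inner_torus v v"
  using assms by (simp add: inner_torus_add_left inner_torus_add_right L2_add inner_torus_commute[of v u])

lemma inner_torus_trig_zero:
  assumes u: "u \<in> L2_torus" and "\<And>k s. k \<in> F \<Longrightarrow> inner_torus u (wave k s) = 0"
    and "p \<in> trig F"
  shows "inner_torus u p = 0"
  using assms(3)
proof (induction rule: trig_induct)
  case zero then show ?case by (simp add: inner_torus_def)
next
  case (step a k s q)
  then show ?case
    using assms by (simp add: inner_torus_add_right inner_torus_cmult_right L2_cmult wave_L2 trig_L2)
qed

text \<open>
The classical derivative of a trigonometric polynomial is a weak derivative, because the derivative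
of \<open>p * \<psi>\<close> has integral zero.
\<close>

lemma partial_by_parts:
  assumes "p \<in> trig F" "has_partial p j q" "periodic \<psi>" "smooth \<psi>" "has_partial \<psi> j \<psi>'"
  shows "(\<integral>x. p x * \<psi>' x \<partial>torus) = - (\<integral>x. q x * \<psi> x \<partial>torus)"
proof -
  have c: "continuous_on UNIV p" "continuous_on UNIV q" "continuous_on UNIV \<psi>" "continuous_on UNIV \<psi>'"
    using assms trig_continuous trig_smooth smooth_continuous smooth_partial_continuous by blast+
  have "(\<integral>x. q x * \<psi> x + p x * \<psi>' x \<partial>torus) = 0"
  proof (rule torus_integral_partial)
    show "has_partial (\<lambda>x. p x * \<psi> x) j (\<lambda>x. q x * \<psi> x + p x * \<psi>' x)"
      using assms by (intro has_partial_mult)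
    show "periodic (\<lambda>x. p x * \<psi> x)"
      using assms trig_periodic by (intro periodic_mult) auto
  qed (use c in \<open>auto intro!: continuous_intros\<close>)
  then show ?thesis
    using c by (subst (asm) Bochner_Integration.integral_add)
      (auto intro!: continuous_torus_integrable continuous_intros)
qed

definition torus_vol :: real where "torus_vol = (\<integral>x. 1 \<partial>torus)"

lemma torus_vol_pos: "torus_vol > 0"
proof -
  have "torus_vol = measure lebesgue cell"
    unfolding torus_vol_def torus_def by (simp add: measure_restrict_space)
  also have "\<dots> > 0"
    by (simp add: content_pos_lt_eq Basis_vec_def inner_axis)
  finally show ?thesis .
qed

text \<open>
A wave of frequency \<open>k \<noteq> 0\<close> is, up to a factor \<open>k $ j \<noteq> 0\<close>, a partial derivative of another wave.
\<close>

lemma integral_wave: "(\<integral>x. wave k s x \<partial>torus) = (if k = 0 \<and> s then torus_vol else 0)"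
proof (cases "k = 0")
  case True
  then show ?thesis by (simp add: wave_def phase_zero torus_vol_def)
next
  case False
  then obtain j where j: "k $ j \<noteq> 0" by (auto simp: vec_eq_iff)
  have "(\<integral>x. (if \<not> s then - 1 else 1) * of_int (k $ j) * wave k (\<not> \<not> s) x \<partial>torus) = 0"
    by (rule torus_integral_partial[OF continuous_on_wave periodic_wave has_partial_wave])
       (intro continuous_intros continuous_on_wave)
  then show ?thesis using j False by (simp split: if_splits)
qed

lemma inner_wave:
  "inner_torus (wave k s) (wave l t) =
    (if s \<noteq> t then 0 else torus_vol / 2 * (of_bool (k = l) + (if s then 1 else - 1) * of_bool (k = - l)))"
proof -
  have [simp]: "integrable torus (wave m r)" for m r
    by (rule continuous_torus_integrable[OF continuous_on_wave])
  show ?thesis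
    unfolding inner_torus_def wave_mult
    by (auto simp: integral_wave add_eq_0_iff2)
qed

section \<open>Density of trigonometric polynomials in the square-integrable functions\<close>

text \<open>
The embedding of the torus into a product of unit circles. On the closed cell it is injective
except for boundary points.
\<close>

definition torus_point :: "real^3 \<Rightarrow> complex^3" where
  "torus_point x = (\<chi> i. cis (x $ i))"

abbreviation open_cell :: "(real^3) set" where
  "open_cell \<equiv> box 0 (\<chi> i. 2 * pi)"

lemma torus_point_eq_imp:
  assumes "x \<in> cell" "y \<in> cell" "torus_point x = torus_point y"
  shows "x = y \<or> x \<notin> open_cell \<and> y \<notin> open_cell"
proof (cases "x = y")
  case False
  then obtain i where i: "x $ i \<noteq> y $ i" by (auto simp: vec_eq_iff)
  have "cis (x $ i) = cis (y $ i)" using assms(3) by (simp add: torus_point_def vec_eq_iff)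
  then have "sin (x $ i) = sin (y $ i) \<and> cos (x $ i) = cos (y $ i)"
    by (simp add: complex_eq_iff)
  then obtain n :: int where n: "x $ i = y $ i + 2 * pi * n"
    unfolding sin_cos_eq_iff by blast
  have b: "0 \<le> x $ i" "x $ i \<le> 2 * pi" "0 \<le> y $ i" "y $ i \<le> 2 * pi"
    using assms(1,2) by (simp_all add: mem_box_cart)
  have "n \<noteq> 0" using n i by auto
  then consider "real_of_int n \<ge> 1" | "real_of_int n \<le> -1" by linarith
  then have "x $ i = 2 * pi \<and> y $ i = 0 \<or> x $ i = 0 \<and> y $ i = 2 * pi"
  proof cases
    case 1
    then have "2 * pi * n \<ge> 2 * pi" by simp
    then show ?thesis using n b by linarith
  next
    case 2
    then have "2 * pi * n \<le> 2 * pi * (- 1)" by (intro mult_left_mono) auto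
    then show ?thesis using n b by linarith
  qed
  then show ?thesis by (auto simp: mem_box_cart intro!: exI[of _ i])
qed simp

lemma continuous_on_torus_point: "continuous_on S torus_point"
  unfolding torus_point_def cis_conv_exp by (intro continuous_intros)

text \<open>
A function that vanishes on the boundary of the cell takes equal values at identified points, so it
factors through \<open>torus_point\<close>. The factor \<open>H\<close> is continuous because \<open>torus_point\<close> maps closed subsets
of the compact cell to closed sets. The functions on the image that pull back to
trigonometric polynomials form an algebra, and the coordinates separate points.
\<close>

lemma trig_uniform_approx:
  assumes h: "continuous_on cell h" "\<And>x. x \<in> cell - open_cell \<Longrightarrow> h x = 0" and "e > 0"
  obtains p where "p \<in> trig UNIV" "\<And>x. x \<in> cell \<Longrightarrow> \<bar>h x - p x\<bar> < e"
proof -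
  define T where "T = torus_point ` cell"
  define H where "H = (\<lambda>z. h (inv_into cell torus_point z))"
  define R where "R = {G. continuous_on T G \<and> (\<exists>p\<in>trig UNIV. \<forall>x\<in>cell. G (torus_point x) = p x)}"
  have H: "H (torus_point x) = h x" if x: "x \<in> cell" for x
  proof -
    define y where "y = inv_into cell torus_point (torus_point x)"
    have "y \<in> cell" "torus_point y = torus_point x"
      using x by (simp_all add: y_def inv_into_into f_inv_into_f)
    then have "h y = h x" using torus_point_eq_imp[of y x] x h(2)[of x] h(2)[of y] by auto
    then show ?thesis by (simp add: H_def y_def)
  qed
  have contH: "continuous_on T H"
    unfolding continuous_closedin_preimage_eq
  proof (intro allI impI)
    fix C :: "real set" assume C: "closed C"
    have "T \<inter> H -` C = torus_point ` (cell \<inter> h -` C)"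
      using H by (auto simp: T_def)
    moreover have "closed (cell \<inter> h -` C)"
      by (rule continuous_closed_preimage) (use h C in auto)
    then have "compact (cell \<inter> (cell \<inter> h -` C))"
      by (intro compact_Int_closed compact_cbox)
    then have "compact (torus_point ` (cell \<inter> h -` C))"
      by (intro compact_continuous_image continuous_on_torus_point) simp
    ultimately have "closed (T \<inter> H -` C)"
      by (simp add: compact_imp_closed)
    then show "closedin (top_of_set T) (T \<inter> H -` C)"
      by (rule closed_subset[rotated]) auto
  qed
  interpret function_ring_on R T
  proof
    show "compact T"
      unfolding T_def by (intro compact_continuous_image continuous_on_torus_point compact_cbox)
    show "continuous_on T f" if "f \<in> R" for f using that by (simp add: R_def)
    show "(\<lambda>x. f x + g x) \<in> R" if fg: "f \<in> R" "g \<in> R" for f g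
    proof -
      obtain p q where "p \<in> trig UNIV" "q \<in> trig UNIV"
        "\<forall>x\<in>cell. f (torus_point x) = p x" "\<forall>x\<in>cell. g (torus_point x) = q x"
        using fg unfolding R_def by blast
      moreover from this have "(\<lambda>x. p x + q x) \<in> trig UNIV"
        unfolding trig_def by (intro fun_span_add)
      ultimately show ?thesis
        using that unfolding R_def by (auto intro!: continuous_intros bexI[of _ "\<lambda>x. p x + q x"])
    qed
    show "(\<lambda>x. f x * g x) \<in> R" if fg: "f \<in> R" "g \<in> R" for f g
    proof -
      obtain p q where "p \<in> trig UNIV" "q \<in> trig UNIV"
        "\<forall>x\<in>cell. f (torus_point x) = p x" "\<forall>x\<in>cell. g (torus_point x) = q x"
        using fg unfolding R_def by blast
      moreover from this have "(\<lambda>x. p x * q x) \<in> trig UNIV"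
        by (intro trig_mult)
      ultimately show ?thesis
        using that unfolding R_def by (auto intro!: continuous_intros bexI[of _ "\<lambda>x. p x * q x"])
    qed
    show "(\<lambda>_. c) \<in> R" for c
      unfolding R_def using trig_const by (auto intro!: bexI[of _ "\<lambda>_. c"])
    have Re: "(\<lambda>z. Re (z $ i)) \<in> R" for i
      unfolding R_def using wave_in_trig[of "axis i 1" UNIV True]
      by (auto intro!: continuous_intros bexI[of _ "wave (axis i 1) True"]
          simp: wave_def phase_axis torus_point_def)
    have Im: "(\<lambda>z. Im (z $ i)) \<in> R" for i
      unfolding R_def using wave_in_trig[of "axis i 1" UNIV False]
      by (auto intro!: continuous_intros bexI[of _ "wave (axis i 1) False"]
          simp: wave_def phase_axis torus_point_def)
    show "\<exists>f\<in>R. f z \<noteq> f w" if zw: "z \<noteq> w" for z w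
    proof -
      obtain i where "Re (z $ i) \<noteq> Re (w $ i) \<or> Im (z $ i) \<noteq> Im (w $ i)"
        using zw by (auto simp: vec_eq_iff complex_eq_iff)
      then show ?thesis
      proof
        assume "Re (z $ i) \<noteq> Re (w $ i)"
        then show ?thesis by (rule bexI[OF _ Re])
      next
        assume "Im (z $ i) \<noteq> Im (w $ i)"
        then show ?thesis by (rule bexI[OF _ Im])
      qed
    qed
  qed
  obtain G where G: "G \<in> R" "\<forall>z\<in>T. \<bar>H z - G z\<bar> < e"
    using Stone_Weierstrass_basic[OF contH \<open>e > 0\<close>] by blast
  then obtain p where p: "p \<in> trig UNIV" "\<forall>x\<in>cell. G (torus_point x) = p x"
    by (auto simp: R_def)
  show ?thesis
  proof (rule that[OF p(1)])
    fix x assume x: "x \<in> cell"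
    then have "\<bar>H (torus_point x) - G (torus_point x)\<bar> < e" using G by (auto simp: T_def)
    then show "\<bar>h x - p x\<bar> < e" using H[OF x] p x by simp
  qed
qed

lemma square_integrable_triangle:
  fixes f g h :: "real^3 \<Rightarrow> real"
  assumes "f \<in> borel_measurable torus" "g \<in> borel_measurable torus" "h \<in> borel_measurable torus"
    and "integrable torus (\<lambda>x. (f x - g x)\<^sup>2)" "integrable torus (\<lambda>x. (g x - h x)\<^sup>2)"
  shows "integrable torus (\<lambda>x. (f x - h x)\<^sup>2)"
    and "(\<integral>x. (f x - h x)\<^sup>2 \<partial>torus) \<le> 2 * (\<integral>x. (f x - g x)\<^sup>2 \<partial>torus) + 2 * (\<integral>x. (g x - h x)\<^sup>2 \<partial>torus)"
proof -
  have le: "(f x - h x)\<^sup>2 \<le> 2 * (f x - g x)\<^sup>2 + 2 * (g x - h x)\<^sup>2" for x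
  proof -
    have "0 \<le> ((f x - g x) - (g x - h x))\<^sup>2" by simp
    then show ?thesis by (simp add: power2_eq_square algebra_simps)
  qed
  have int: "integrable torus (\<lambda>x. 2 * (f x - g x)\<^sup>2 + 2 * (g x - h x)\<^sup>2)"
    using assms by simp
  show i: "integrable torus (\<lambda>x. (f x - h x)\<^sup>2)"
    using int by (rule Bochner_Integration.integrable_bound)
      (use assms le in \<open>auto intro!: AE_I2 order_trans[OF _ abs_ge_self]\<close>)
  have "(\<integral>x. (f x - h x)\<^sup>2 \<partial>torus) \<le> (\<integral>x. 2 * (f x - g x)\<^sup>2 + 2 * (g x - h x)\<^sup>2 \<partial>torus)"
    using i int le by (intro integral_mono) auto
  then show "(\<integral>x. (f x - h x)\<^sup>2 \<partial>torus) \<le> 2 * (\<integral>x. (f x - g x)\<^sup>2 \<partial>torus) + 2 * (\<integral>x. (g x - h x)\<^sup>2 \<partial>torus)"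
    using assms by simp
qed

text \<open>
Truncation of the values to \<open>[- n, n]\<close>; the squared error is dominated by \<open>(f x)\<^sup>2\<close>.
\<close>

lemma bounded_approx_L2:
  fixes f :: "real^3 \<Rightarrow> real"
  assumes f: "f \<in> borel_measurable torus" "integrable torus (\<lambda>x. (f x)\<^sup>2)" and "e > 0"
  obtains g M where "g \<in> borel_measurable torus" "M \<ge> 0" "\<And>x. \<bar>g x\<bar> \<le> M"
    "integrable torus (\<lambda>x. (f x - g x)\<^sup>2)" "(\<integral>x. (f x - g x)\<^sup>2 \<partial>torus) < e"
proof -
  define g where "g n x = max (- real n) (min (real n) (f x))" for n x
  have meas: "g n \<in> borel_measurable torus" for n
    unfolding g_def using f by measurable
  have le: "(f x - g n x)\<^sup>2 \<le> (f x)\<^sup>2" for n x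
    by (rule abs_le_square_iff[THEN iffD1]) (auto simp: g_def max_def min_def)
  have "(\<lambda>n. \<integral>x. (f x - g n x)\<^sup>2 \<partial>torus) \<longlonglongrightarrow> (\<integral>x. 0 \<partial>torus)"
  proof (rule integral_dominated_convergence[OF _ _ f(2)])
    show "AE x in torus. (\<lambda>n. (f x - g n x)\<^sup>2) \<longlonglongrightarrow> 0"
    proof (intro AE_I2)
      fix x
      have "\<forall>\<^sub>F n in sequentially. real n \<ge> \<bar>f x\<bar>"
        using filterlim_real_sequentially by (simp add: filterlim_at_top)
      then have "\<forall>\<^sub>F n in sequentially. (f x - g n x)\<^sup>2 = 0"
        by eventually_elim (auto simp: g_def)
      then show "(\<lambda>n. (f x - g n x)\<^sup>2) \<longlonglongrightarrow> 0" by (rule tendsto_eventually)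
    qed
  qed (use meas f le in auto)
  then have "\<forall>\<^sub>F n in sequentially. (\<integral>x. (f x - g n x)\<^sup>2 \<partial>torus) < e"
    using \<open>e > 0\<close> by (simp add: order_tendstoD)
  then obtain n where n: "(\<integral>x. (f x - g n x)\<^sup>2 \<partial>torus) < e"
    by (meson eventually_sequentially le_refl)
  have "integrable torus (\<lambda>x. (f x - g n x)\<^sup>2)"
    using f(2) by (rule Bochner_Integration.integrable_bound) (use meas[of n] f le in auto)
  then show ?thesis
    using n meas[of n] by (intro that[of "g n" "real n"]) (auto simp: g_def)
qed

text \<open>
A measurable function is almost everywhere the limit of continuous functions \<open>g n\<close>. Clamping to
\<open>[- M, M]\<close> makes them uniformly bounded, and the cutoff \<open>c n\<close> makes them vanish outside the open cell
while tending to \<open>1\<close> inside; neither changes the limit, and dominated convergence applies.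
\<close>

lemma continuous_approx_L2:
  fixes f :: "real^3 \<Rightarrow> real"
  assumes f: "f \<in> borel_measurable torus" "\<And>x. \<bar>f x\<bar> \<le> M" and "M \<ge> 0" "e > 0"
  obtains h where "continuous_on UNIV h" "\<And>x. x \<notin> open_cell \<Longrightarrow> h x = 0"
    "integrable torus (\<lambda>x. (f x - h x)\<^sup>2)" "(\<integral>x. (f x - h x)\<^sup>2 \<partial>torus) < e"
proof -
  have "f measurable_on cell"
    using f(1) unfolding torus_def by (simp add: measurable_on_iff_borel_measurable)
  then obtain N g where N: "negligible N" and g: "\<And>n. continuous_on UNIV (g n)"
    and lim: "\<And>x. x \<notin> N \<Longrightarrow> (\<lambda>n. g n x) \<longlonglongrightarrow> (if x \<in> cell then f x else 0)"
    unfolding measurable_on_def by blast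
  define c where "c n x = min 1 (real n * infdist x (- open_cell))" for n x
  define h where "h n x = c n x * max (- M) (min M (g n x))" for n x
  have clamp: "\<bar>max (- M) (min M a)\<bar> \<le> M" for a
    using \<open>M \<ge> 0\<close> by auto
  have c: "0 \<le> c n x" "c n x \<le> 1" for n x
    by (simp_all add: c_def infdist_nonneg)
  have bound: "\<bar>h n x\<bar> \<le> M" for n x
  proof -
    have "\<bar>h n x\<bar> = c n x * \<bar>max (- M) (min M (g n x))\<bar>"
      using c[of n x] by (simp add: h_def abs_mult)
    also have "\<dots> \<le> 1 * M" using c clamp by (intro mult_mono) auto
    finally show ?thesis by simp
  qed
  have cont: "continuous_on UNIV (h n)" for n
    unfolding h_def c_def by (intro continuous_intros g)
  have zero: "h n x = 0" if "x \<notin> open_cell" for n x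
    using that by (simp add: h_def c_def)
  have sq: "(f x - h n x)\<^sup>2 \<le> (2 * M)\<^sup>2" for n x
  proof -
    have "\<bar>f x - h n x\<bar> \<le> \<bar>2 * M\<bar>" using f(2)[of x] bound[of n x] by arith
    then show ?thesis by (rule abs_le_square_iff[THEN iffD1])
  qed
  have conv: "(\<lambda>n. (f x - h n x)\<^sup>2) \<longlonglongrightarrow> 0" if x: "x \<in> open_cell" "x \<notin> N" for x
  proof -
    have ne: "- open_cell \<noteq> {}"
      using bounded_box[of "0::real^3" "\<chi> i. 2 * pi"] not_bounded_UNIV by (metis Compl_empty_eq double_complement)
    have pos: "infdist x (- open_cell) > 0"
      using x ne by (intro infdist_pos_not_in_closed) (auto simp: open_box closed_Compl)
    have "filterlim (\<lambda>n. infdist x (- open_cell) * real n) at_top sequentially"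
      by (rule filterlim_tendsto_pos_mult_at_top[OF tendsto_const pos filterlim_real_sequentially])
    then have "\<forall>\<^sub>F n in sequentially. 1 \<le> infdist x (- open_cell) * real n"
      by (simp add: filterlim_at_top)
    then have "\<forall>\<^sub>F n in sequentially. c n x = 1"
      by eventually_elim (simp add: c_def mult.commute)
    then have "(\<lambda>n. c n x) \<longlonglongrightarrow> 1" by (rule tendsto_eventually)
    moreover have "(\<lambda>n. g n x) \<longlonglongrightarrow> f x"
      using lim[of x] x box_subset_cbox by (auto split: if_splits)
    ultimately have "(\<lambda>n. h n x) \<longlonglongrightarrow> 1 * max (- M) (min M (f x))"
      unfolding h_def by (intro tendsto_intros)
    moreover have "max (- M) (min M (f x)) = f x" using f(2)[of x] by (auto simp: max_def min_def)
    ultimately have "(\<lambda>n. (f x - h n x)\<^sup>2) \<longlonglongrightarrow> (f x - f x)\<^sup>2"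
      by (intro tendsto_intros) simp
    then show ?thesis by simp
  qed
  have "negligible (N \<union> (cell - open_cell))"
    by (intro negligible_Un N negligible_frontier_interval)
  then have ae0: "AE x in lebesgue. x \<notin> N \<union> (cell - open_cell)"
    unfolding negligible_iff_null_sets by (rule AE_not_in)
  then have ae: "AE x in torus. (\<lambda>n. (f x - h n x)\<^sup>2) \<longlonglongrightarrow> 0"
    unfolding torus_def
  proof (subst AE_restrict_space_iff)
    show "AE x in lebesgue. x \<in> cell \<longrightarrow> (\<lambda>n. (f x - h n x)\<^sup>2) \<longlonglongrightarrow> 0"
      using ae0 by eventually_elim (use conv in blast)
  qed simp
  have meas: "(\<lambda>x. (f x - h n x)\<^sup>2) \<in> borel_measurable torus" for n
    using f(1) continuous_torus_measurable[OF cont] by measurable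
  have const: "integrable torus (\<lambda>x. (2 * M)\<^sup>2)"
    by (intro continuous_torus_integrable continuous_intros)
  have "(\<lambda>n. \<integral>x. (f x - h n x)\<^sup>2 \<partial>torus) \<longlonglongrightarrow> (\<integral>x. 0 \<partial>torus)"
    by (rule integral_dominated_convergence[OF _ meas const ae]) (use sq in auto)
  then have "\<forall>\<^sub>F n in sequentially. (\<integral>x. (f x - h n x)\<^sup>2 \<partial>torus) < e"
    using \<open>e > 0\<close> by (simp add: order_tendstoD)
  then obtain n where n: "(\<integral>x. (f x - h n x)\<^sup>2 \<partial>torus) < e"
    by (meson eventually_sequentially le_refl)
  have "integrable torus (\<lambda>x. (f x - h n x)\<^sup>2)"
    using const by (rule Bochner_Integration.integrable_bound) (use meas[of n] sq in auto)
  then show ?thesis using n cont zero by (intro that[of "h n"])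
qed

lemma trig_dense_L2:
  assumes f: "f \<in> L2_torus" and e: "e > 0"
  obtains p where "p \<in> trig UNIV" "inner_torus (\<lambda>x. f x - p x) (\<lambda>x. f x - p x) < e"
proof -
  have f': "f \<in> borel_measurable torus" "integrable torus (\<lambda>x. (f x)\<^sup>2)"
    using f by (auto simp: L2_torus_def)
  obtain g M where g: "g \<in> borel_measurable torus" "M \<ge> 0" "\<And>x. \<bar>g x\<bar> \<le> M"
    "integrable torus (\<lambda>x. (f x - g x)\<^sup>2)" "(\<integral>x. (f x - g x)\<^sup>2 \<partial>torus) < e / 12"
    using bounded_approx_L2[OF f', of "e / 12"] e by auto
  obtain h where h: "continuous_on UNIV h" "\<And>x. x \<notin> open_cell \<Longrightarrow> h x = 0"
    "integrable torus (\<lambda>x. (g x - h x)\<^sup>2)" "(\<integral>x. (g x - h x)\<^sup>2 \<partial>torus) < e / 12"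
    using continuous_approx_L2[OF g(1,3,2), of "e / 12"] e by auto
  \<comment> \<open>A uniform error \<open>d\<close> contributes \<open>d\<^sup>2 * torus_vol = e / 6\<close>. Using the triangle inequality for squares
    twice, the total is below \<open>4 * e / 12 + 4 * e / 12 + 2 * e / 6 = e\<close>.\<close>
  define d where "d = sqrt (e / (6 * torus_vol))"
  have "d > 0" using e torus_vol_pos by (simp add: d_def)
  then obtain p where p: "p \<in> trig UNIV" "\<And>x. x \<in> cell \<Longrightarrow> \<bar>h x - p x\<bar> < d"
    using trig_uniform_approx[of h d] h by (auto intro: continuous_on_subset)
  have meas: "h \<in> borel_measurable torus" "p \<in> borel_measurable torus"
    using h p trig_continuous continuous_torus_measurable by blast+
  have hp: "integrable torus (\<lambda>x. (h x - p x)\<^sup>2)"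
    using h p trig_continuous by (intro continuous_torus_integrable continuous_intros) auto
  have "(\<integral>x. (h x - p x)\<^sup>2 \<partial>torus) \<le> (\<integral>x. d\<^sup>2 * 1 \<partial>torus)"
  proof (rule integral_mono[OF hp])
    show "integrable torus (\<lambda>x. d\<^sup>2 * 1)"
      by (intro continuous_torus_integrable continuous_intros)
    show "(h x - p x)\<^sup>2 \<le> d\<^sup>2 * 1" if "x \<in> space torus" for x
      using p(2)[of x] that \<open>d > 0\<close> by (simp add: space_torus abs_le_square_iff[symmetric])
  qed
  also have "\<dots> = d\<^sup>2 * torus_vol"
    unfolding torus_vol_def by (rule integral_mult_right_zero)
  also have "\<dots> = e / 6"
    using e torus_vol_pos by (simp add: d_def)
  finally have hp2: "(\<integral>x. (h x - p x)\<^sup>2 \<partial>torus) \<le> e / 6" .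
  note fh = square_integrable_triangle[OF f'(1) g(1) meas(1) g(4) h(3)]
  note fp = square_integrable_triangle[OF f'(1) meas fh(1) hp]
  have "inner_torus (\<lambda>x. f x - p x) (\<lambda>x. f x - p x) < e"
    unfolding inner_torus_self using fh(2) fp(2) hp2 g(5) h(4) by linarith
  then show ?thesis using p that by blast
qed

section \<open>Density of trigonometric polynomials in the Sobolev space\<close>

lemma weak_partial_trig:
  assumes "p \<in> trig F" "has_partial p j q" shows "weak_partial p j q"
proof -
  have "q \<in> L2_torus"
    using assms smooth_partial_continuous[OF trig_smooth] periodic_partial[OF trig_periodic]
    by (intro continuous_periodic_L2) auto
  then show ?thesis
    unfolding weak_partial_def using partial_by_parts[OF assms] by blast
qed

lemma trig_H1: "p \<in> trig F \<Longrightarrow> p \<in> H1_torus"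
  unfolding H1_torus_def using trig_L2 weak_partial_trig trig_has_partial by blast

lemma weak_partial_diff:
  assumes "u \<in> L2_torus" "v \<in> L2_torus" "weak_partial u j g" "weak_partial v j h"
  shows "weak_partial (\<lambda>x. u x - v x) j (\<lambda>x. g x - h x)"
  unfolding weak_partial_def
proof (intro conjI allI impI)
  show "(\<lambda>x. g x - h x) \<in> L2_torus"
    using assms by (intro L2_diff) (auto simp: weak_partial_def)
  fix \<psi> \<psi>' assume \<psi>: "periodic \<psi> \<and> smooth \<psi> \<and> has_partial \<psi> j \<psi>'"
  have L2: "\<psi> \<in> L2_torus" "\<psi>' \<in> L2_torus" "g \<in> L2_torus" "h \<in> L2_torus"
    using \<psi> assms smooth_continuous smooth_partial_continuous periodic_partial continuous_periodic_L2
    by (auto simp: weak_partial_def)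
  have "inner_torus u \<psi>' = - inner_torus g \<psi>" "inner_torus v \<psi>' = - inner_torus h \<psi>"
    using assms \<psi> unfolding weak_partial_def inner_torus_def by blast+
  then show "(\<integral>x. (u x - v x) * \<psi>' x \<partial>torus) = - (\<integral>x. (g x - h x) * \<psi> x \<partial>torus)"
    using inner_torus_diff_left[OF assms(1,2) L2(2)] inner_torus_diff_left[OF L2(3,4,1)]
    by (simp add: inner_torus_def)
qed

lemma weak_partial_inner_trig:
  assumes "weak_partial u j g" "p \<in> trig F" "has_partial p j q"
  shows "inner_torus u q = - inner_torus g p"
  using assms trig_periodic trig_smooth unfolding weak_partial_def inner_torus_def by blast

text \<open>
If \<open>d\<close> is orthogonal to \<open>p\<close>, then \<open>d - p\<close> is no shorter than \<open>d\<close>; so density forces \<open>d\<close> to have norm zero.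
\<close>

lemma trig_orthogonal_imp_null:
  assumes d: "d \<in> L2_torus" and orth: "\<And>p. p \<in> trig UNIV \<Longrightarrow> inner_torus d p = 0"
  shows "inner_torus d d = 0"
proof (rule ccontr)
  assume "inner_torus d d \<noteq> 0"
  then have "inner_torus d d > 0" using inner_torus_self_nonneg[of d] by simp
  then obtain p where p: "p \<in> trig UNIV"
    "inner_torus (\<lambda>x. d x - p x) (\<lambda>x. d x - p x) < inner_torus d d"
    using trig_dense_L2[OF d] by blast
  moreover have "inner_torus (\<lambda>x. d x - p x) (\<lambda>x. d x - p x) = inner_torus d d + inner_torus p p"
    using d trig_L2[OF p(1)] orth[OF p(1)]
    by (simp add: inner_torus_diff_left inner_torus_diff_right L2_diff inner_torus_commute[of p d])
  ultimately show False using inner_torus_self_nonneg[of p] by simp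
qed

text \<open>
The difference of two weak derivatives is orthogonal to all test functions, in particular to all
trigonometric polynomials. This makes the Sobolev norm independent of the choice of derivatives.
\<close>

lemma weak_partial_unique:
  assumes "weak_partial u j g" "weak_partial u j h"
  shows "inner_torus g g = inner_torus h h"
proof -
  have L2: "g \<in> L2_torus" "h \<in> L2_torus" using assms by (auto simp: weak_partial_def)
  define d where "d = (\<lambda>x. g x - h x)"
  have d: "d \<in> L2_torus" unfolding d_def using L2 by (rule L2_diff)
  have "inner_torus d d = 0"
  proof (rule trig_orthogonal_imp_null[OF d])
    fix p assume p: "p \<in> trig UNIV"
    then obtain q where q: "has_partial p j q" using trig_has_partial by blast
    show "inner_torus d p = 0"
      using weak_partial_inner_trig[OF assms(1) p q] weak_partial_inner_trig[OF assms(2) p q]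
        inner_torus_diff_left[OF L2 trig_L2[OF p]] by (simp add: d_def)
  qed
  then have "AE x in torus. (d x)\<^sup>2 = 0"
    using d unfolding inner_torus_self
    by (subst (asm) integral_nonneg_eq_0_iff_AE) (auto simp: L2_torus_def)
  then have "AE x in torus. (g x)\<^sup>2 = (h x)\<^sup>2"
    by eventually_elim (simp add: d_def)
  then show ?thesis
    unfolding inner_torus_self using L2 by (intro integral_cong_AE) (auto simp: L2_torus_def)
qed

lemma H1_norm_eq:
  assumes "\<And>j. weak_partial u j (g j)"
  shows "H1_norm u = sqrt (inner_torus u u + (\<Sum>j\<in>UNIV. inner_torus (g j) (g j)))"
proof -
  have "weak_partial u j (SOME g. weak_partial u j g)" for j
    by (rule someI[of "weak_partial u j", OF assms])
  then have "inner_torus (SOME g. weak_partial u j g) (SOME g. weak_partial u j g) = inner_torus (g j) (g j)"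
    for j using assms weak_partial_unique by blast
  then show ?thesis by (simp add: H1_norm_def inner_torus_self)
qed

lemma inner_torus_le_H1_norm: "inner_torus u u \<le> (H1_norm u)\<^sup>2"
proof -
  have "0 \<le> (\<Sum>j\<in>UNIV. \<integral>x. ((SOME g. weak_partial u j g) x)\<^sup>2 \<partial>torus)"
    by (intro sum_nonneg) simp
  moreover have "0 \<le> (\<integral>x. (u x)\<^sup>2 \<partial>torus)" by simp
  ultimately show ?thesis
    unfolding H1_norm_def inner_torus_self by simp
qed

text \<open>
The projection is the Fourier partial sum over \<open>F\<close>. Each unoriented frequency occurs twice in \<open>F\<close>,
as \<open>k\<close> and as \<open>- k\<close>, which turns the squared length \<open>torus_vol / 2\<close> of a wave into the denominator
\<open>torus_vol\<close>; for \<open>k = 0\<close> the cosine has squared length \<open>torus_vol\<close> and occurs once.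
\<close>

lemma trig_projection:
  assumes F: "finite F" "uminus ` F = F" and u: "u \<in> L2_torus"
  obtains \<phi> where "\<phi> \<in> trig F" "\<And>p. p \<in> trig F \<Longrightarrow> inner_torus (\<lambda>x. u x - \<phi> x) p = 0"
proof -
  define \<phi> where "\<phi> = (\<lambda>x. \<Sum>k\<in>F. \<Sum>s\<in>UNIV. inner_torus u (wave k s) / torus_vol * wave k s x)"
  have \<phi>: "\<phi> \<in> trig F"
    unfolding \<phi>_def trig_def
    using wave_in_trig by (intro fun_span_sum fun_span_scale) (auto simp: trig_def)
  have minus: "inner_torus u (wave (- l) s) = (if s then 1 else - 1) * inner_torus u (wave l s)" for l s
    by (simp add: inner_torus_def wave_def phase_minus)
  have "inner_torus \<phi> (wave l t) = inner_torus u (wave l t)" if l: "l \<in> F" for l t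
  proof -
    let ?c = "\<lambda>k s. inner_torus u (wave k s) / torus_vol"
    have l': "- l \<in> F" using l F by blast
    have terms: "(\<lambda>x. ?c k s * wave k s x) \<in> L2_torus" for k s
      by (intro L2_cmult wave_L2)
    then have L2: "(\<lambda>x. \<Sum>s\<in>UNIV. ?c k s * wave k s x) \<in> L2_torus" for k
      by (auto simp: UNIV_bool intro!: L2_add)
    have "inner_torus \<phi> (wave l t) = (\<Sum>k\<in>F. \<Sum>s\<in>UNIV. ?c k s * inner_torus (wave k s) (wave l t))"
      unfolding \<phi>_def
      by (subst inner_torus_sum_left, rule L2, rule wave_L2,
          subst inner_torus_sum_left, rule terms, rule wave_L2, simp only: inner_torus_cmult_left)
    also have "\<dots> = (\<Sum>k\<in>F. ?c k t * (torus_vol / 2 * of_bool (k = l))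
        + ?c k t * (torus_vol / 2 * ((if t then 1 else - 1) * of_bool (k = - l))))"
      by (rule sum.cong) (auto simp: UNIV_bool inner_wave distrib_left)
    also have "\<dots> = inner_torus u (wave l t) / 2 + (if t then 1 else - 1) * inner_torus u (wave (- l) t) / 2"
      using F l l' torus_vol_pos
      by (simp add: sum.distrib of_bool_def if_distrib[of "\<lambda>x. _ * x"] sum.delta cong: if_cong)
    also have "\<dots> = inner_torus u (wave l t)" by (simp add: minus)
    finally show ?thesis .
  qed
  then have "inner_torus (\<lambda>x. u x - \<phi> x) (wave l t) = 0" if "l \<in> F" for l t
    using that inner_torus_diff_left[OF u trig_L2[OF \<phi>] wave_L2] by simp
  then show ?thesis
    using \<phi> inner_torus_trig_zero[OF L2_diff[OF u trig_L2[OF \<phi>]]] that by blast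
qed

lemma trig_projection_minimal:
  assumes u: "u \<in> L2_torus" and "\<phi> \<in> trig F" "p \<in> trig F"
    and orth: "\<And>p. p \<in> trig F \<Longrightarrow> inner_torus (\<lambda>x. u x - \<phi> x) p = 0"
  shows "inner_torus (\<lambda>x. u x - \<phi> x) (\<lambda>x. u x - \<phi> x) \<le> inner_torus (\<lambda>x. u x - p x) (\<lambda>x. u x - p x)"
proof -
  have d: "(\<lambda>x. \<phi> x - p x) \<in> trig F"
    using assms unfolding trig_def by (intro fun_span_diff)
  have "inner_torus (\<lambda>x. (u x - \<phi> x) + (\<phi> x - p x)) (\<lambda>x. (u x - \<phi> x) + (\<phi> x - p x)) =
      inner_torus (\<lambda>x. u x - \<phi> x) (\<lambda>x. u x - \<phi> x) + inner_torus (\<lambda>x. \<phi> x - p x) (\<lambda>x. \<phi> x - p x)"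
    by (rule pythagoras_torus[OF L2_diff[OF u trig_L2] trig_L2[OF d] orth[OF d]]) fact
  then show ?thesis using inner_torus_self_nonneg[of "\<lambda>x. \<phi> x - p x"] by simp
qed

text \<open>
Let \<open>\<phi>\<close> be the projection of \<open>u\<close> to the frequencies in \<open>F\<close>. For \<open>p\<close> with frequencies in \<open>F\<close>,
integration by parts moves the derivative from \<open>g j - h j\<close> to \<open>p\<close> and leaves the inner product of
\<open>u - \<phi>\<close> with another trigonometric polynomial over \<open>F\<close>, which is zero. So \<open>h j\<close>, the derivative of
\<open>\<phi>\<close>, is the projection of \<open>g j\<close>, and best approximation applies to all four functions once \<open>F\<close>
contains the frequencies of \<open>L\<^sup>2\<close>-approximations to each of them.
\<close>

lemma trig_dense_H1: "dense_in_H1 (trig UNIV)"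
  unfolding dense_in_H1_def
proof (intro conjI ballI allI impI)
  show "trig UNIV \<subseteq> H1_torus" using trig_H1 by blast
  fix u and \<delta> :: real assume u: "u \<in> H1_torus" and \<delta>: "\<delta> > 0"
  then have u2: "u \<in> L2_torus" by (simp add: H1_torus_def)
  obtain g where g: "\<And>j. weak_partial u j (g j)"
    using u unfolding H1_torus_def by (simp, metis)
  then have g2: "g j \<in> L2_torus" for j by (simp add: weak_partial_def)
  \<comment> \<open>Four squared errors are added, one for \<open>u\<close> and three for the derivatives.\<close>
  define e where "e = \<delta>\<^sup>2 / 4"
  have e: "e > 0" using \<delta> by (simp add: e_def)
  have approx: "\<exists>p F. finite F \<and> p \<in> trig F \<and> inner_torus (\<lambda>x. f x - p x) (\<lambda>x. f x - p x) < e"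
    if "f \<in> L2_torus" for f
    using trig_dense_L2[OF that e] trig_finite_support by metis
  obtain p0 F0 where p0: "finite F0" "p0 \<in> trig F0"
    "inner_torus (\<lambda>x. u x - p0 x) (\<lambda>x. u x - p0 x) < e"
    using approx[OF u2] by blast
  obtain p G where p: "\<And>j. finite (G j)" "\<And>j. p j \<in> trig (G j)"
    "\<And>j. inner_torus (\<lambda>x. g j x - p j x) (\<lambda>x. g j x - p j x) < e"
    using approx[OF g2] by metis
  define F1 where "F1 = F0 \<union> (\<Union>j. G j)"
  define F where "F = F1 \<union> uminus ` F1"
  have F: "finite F" "uminus ` F = F"
    using p p0 by (auto simp: F_def F1_def image_Un image_image)
  have p0F: "p0 \<in> trig F" using p0 trig_mono[of F0 F] by (auto simp: F_def F1_def)
  have pF: "p j \<in> trig F" for j using p trig_mono[of "G j" F] by (auto simp: F_def F1_def)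
  obtain \<phi> where \<phi>: "\<phi> \<in> trig F" and orth: "\<And>p. p \<in> trig F \<Longrightarrow> inner_torus (\<lambda>x. u x - \<phi> x) p = 0"
    using trig_projection[OF F u2] by blast
  obtain h where h: "\<And>j. h j \<in> trig F" "\<And>j. has_partial \<phi> j (h j)"
    using trig_has_partial[OF \<phi>] by metis
  have wp: "weak_partial (\<lambda>x. u x - \<phi> x) j (\<lambda>x. g j x - h j x)" for j
    using g h weak_partial_trig[OF \<phi>] trig_L2[OF \<phi>] u2 by (intro weak_partial_diff) auto
  have orth': "inner_torus (\<lambda>x. g j x - h j x) r = 0" if r: "r \<in> trig F" for j r
  proof -
    obtain q where "q \<in> trig F" "has_partial r j q" using trig_has_partial[OF r] by blast
    then show ?thesis using weak_partial_inner_trig[OF wp r] orth by force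
  qed
  have "inner_torus (\<lambda>x. u x - \<phi> x) (\<lambda>x. u x - \<phi> x) < e"
    using trig_projection_minimal[OF u2 \<phi> p0F orth] p0(3) by simp
  moreover have "inner_torus (\<lambda>x. g j x - h j x) (\<lambda>x. g j x - h j x) < e" for j
    using trig_projection_minimal[OF g2 h(1) pF orth'] p(3)[of j] by (rule le_less_trans)
  then have "(\<Sum>j\<in>UNIV. inner_torus (\<lambda>x. g j x - h j x) (\<lambda>x. g j x - h j x)) < (\<Sum>j\<in>(UNIV :: 3 set). e)"
    by (intro sum_strict_mono) auto
  ultimately have "inner_torus (\<lambda>x. u x - \<phi> x) (\<lambda>x. u x - \<phi> x) +
      (\<Sum>j\<in>UNIV. inner_torus (\<lambda>x. g j x - h j x) (\<lambda>x. g j x - h j x)) < \<delta>\<^sup>2"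
    by (simp add: e_def)
  then have "H1_norm (\<lambda>x. u x - \<phi> x) < \<delta>"
    unfolding H1_norm_eq[OF wp] using \<delta> by (intro real_less_lsqrt) auto
  then show "\<exists>\<phi>\<in>trig UNIV. H1_norm (\<lambda>x. u x - \<phi> x) < \<delta>"
    using \<phi> trig_mono[of F UNIV] by blast
qed

section \<open>Saturation in terms of frequencies\<close>

text \<open>
Sums of an odd number of elements of \<open>A\<close>. The steps by two elements reflect that saturation
multiplies by two profiles at a time.
\<close>

inductive_set odd_sums :: "(int^3) set \<Rightarrow> (int^3) set" for A where
  odd_sums_base: "k \<in> A \<Longrightarrow> k \<in> odd_sums A"
| odd_sums_step: "n \<in> odd_sums A \<Longrightarrow> k \<in> A \<Longrightarrow> l \<in> A \<Longrightarrow> n + k + l \<in> odd_sums A"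

lemma modes_uminus: "k \<in> modes K \<epsilon> \<Longrightarrow> - k \<in> modes K \<epsilon>"
  by (auto simp: modes_def split: if_splits)

lemma odd_sums_uminus:
  assumes "n \<in> odd_sums (modes K \<epsilon>)" shows "- n \<in> odd_sums (modes K \<epsilon>)"
  using assms
proof induction
  case (odd_sums_step n k l)
  then have "- n + - k + - l \<in> odd_sums (modes K \<epsilon>)"
    by (intro odd_sums.odd_sums_step modes_uminus)
  then show ?case by simp
qed (auto intro: odd_sums_base modes_uminus)

lemma profiles_eq_waves:
  "profiles K \<epsilon> = (if \<epsilon> = 1 then {wave 0 True} else {}) \<union> (\<Union>k\<in>K. range (wave k))"
  unfolding profiles_def by (auto simp: wave_def phase_zero UNIV_bool)

lemma profile_is_wave:
  assumes "b \<in> profiles K \<epsilon>" obtains k s where "k \<in> modes K \<epsilon>" "b = wave k s"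
  using assms unfolding profiles_eq_waves modes_def by (auto split: if_splits)

text \<open>
The modes \<open>- k\<close> and \<open>0\<close> contribute waves that are profiles only up to a factor: a sign for the sine of
\<open>- k\<close>, and \<open>0\<close> for the sine of frequency \<open>0\<close>.
\<close>

lemma wave_mode_is_multiple_of_profile:
  assumes "k \<in> modes K \<epsilon>"
  obtains c b where "b \<in> profiles K \<epsilon>" "wave k s = (\<lambda>x. c * b x)"
proof -
  consider "k \<in> K" | "- k \<in> K" | "k = 0" "\<epsilon> = 1"
    using assms by (auto simp: modes_def split: if_splits)
  then show ?thesis
  proof cases
    case 1
    then show ?thesis by (intro that[of "wave k s" 1]) (auto simp: profiles_eq_waves)
  next
    case 2
    then show ?thesis
      by (intro that[of "wave (- k) s" "if s then 1 else - 1"])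
         (auto simp: profiles_eq_waves wave_def phase_minus)
  next
    case 3
    then show ?thesis
      by (intro that[of "wave 0 True" "if s then 1 else 0"])
         (auto simp: profiles_eq_waves wave_def phase_zero)
  qed
qed

lemma saturation_limit_mult:
  assumes "\<phi> \<in> saturation_limit K \<epsilon>" "b \<in> profiles K \<epsilon>" "b' \<in> profiles K \<epsilon>"
  shows "(\<lambda>x. \<phi> x * b x * b' x) \<in> saturation_limit K \<epsilon>"
  using assms(1) unfolding saturation_limit_def
proof (induction rule: fun_span_induct)
  case zero
  then show ?case by (simp add: fun_span_zero)
next
  case (step a g h)
  then obtain n where "g \<in> saturation K \<epsilon> n" by blast
  then have "(\<lambda>x. g x * b x * b' x) \<in> saturation K \<epsilon> (Suc n)"
    using assms by auto
  then have "(\<lambda>x. g x * b x * b' x) \<in> fun_span (\<Union>n. saturation K \<epsilon> n)"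
    by (intro fun_span_base) blast
  then have "(\<lambda>x. a * (g x * b x * b' x) + h x * b x * b' x) \<in> fun_span (\<Union>n. saturation K \<epsilon> n)"
    using step by (intro fun_span_add fun_span_scale)
  then show ?case by (simp add: algebra_simps)
qed

lemma saturation_limit_mult_wave:
  assumes "\<phi> \<in> saturation_limit K \<epsilon>" "k \<in> modes K \<epsilon>" "l \<in> modes K \<epsilon>"
  shows "(\<lambda>x. \<phi> x * wave k s x * wave l t x) \<in> saturation_limit K \<epsilon>"
proof -
  obtain c b where b: "b \<in> profiles K \<epsilon>" "wave k s = (\<lambda>x. c * b x)"
    using wave_mode_is_multiple_of_profile[OF assms(2)] .
  obtain c' b' where b': "b' \<in> profiles K \<epsilon>" "wave l t = (\<lambda>x. c' * b' x)"
    using wave_mode_is_multiple_of_profile[OF assms(3)] .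
  have "(\<lambda>x. (c * c') * (\<phi> x * b x * b' x)) \<in> saturation_limit K \<epsilon>"
    using saturation_limit_mult[OF assms(1) b(1) b'(1)]
    unfolding saturation_limit_def by (rule fun_span_scale)
  then show ?thesis by (simp add: b b' algebra_simps)
qed

text \<open>
The addition theorems express a wave of frequency \<open>n + k + l\<close> through products of waves of the
frequencies \<open>n\<close>, \<open>k\<close> and \<open>l\<close>.
\<close>

lemma wave_in_saturation_limit:
  assumes "n \<in> odd_sums (modes K \<epsilon>)" shows "wave n s \<in> saturation_limit K \<epsilon>"
  using assms
proof (induction arbitrary: s)
  case (odd_sums_base k)
  obtain c b where b: "b \<in> profiles K \<epsilon>" "wave k s = (\<lambda>x. c * b x)"
    using wave_mode_is_multiple_of_profile[OF odd_sums_base] .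
  then have "b \<in> saturation K \<epsilon> 0" by simp
  then show ?case
    unfolding b(2) saturation_limit_def by (intro fun_span_scale fun_span_base) blast
next
  case (odd_sums_step n k l)
  let ?P = "\<lambda>r r' r''. \<lambda>x. wave n r x * wave k r' x * wave l r'' x"
  have P: "?P r r' r'' \<in> fun_span (\<Union>n. saturation K \<epsilon> n)" for r r' r''
    using saturation_limit_mult_wave[OF odd_sums_step.IH odd_sums_step.hyps(2,3)]
    by (simp add: saturation_limit_def)
  have "wave (n + k + l) True = (\<lambda>x. ?P True True True x - ?P False False True x -
      (?P False True False x + ?P True False False x))"
    by (simp add: wave_def phase_add cos_add sin_add fun_eq_iff algebra_simps)
  moreover have "wave (n + k + l) False = (\<lambda>x. (?P False True True x + ?P True False True x) +
      (?P True True False x - ?P False False False x))"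
    by (simp add: wave_def phase_add cos_add sin_add fun_eq_iff algebra_simps)
  ultimately show ?case
    unfolding saturation_limit_def
    by (cases s) (simp_all only:, (intro fun_span_add fun_span_diff P)+)
qed

lemma saturation_subset_trig: "saturation K \<epsilon> n \<subseteq> trig (odd_sums (modes K \<epsilon>))"
proof (induction n)
  case 0
  show ?case
  proof
    fix b assume "b \<in> saturation K \<epsilon> 0"
    then obtain k s where "k \<in> modes K \<epsilon>" "b = wave k s"
      using profile_is_wave[of b K \<epsilon>] by auto
    then show "b \<in> trig (odd_sums (modes K \<epsilon>))" by (auto intro: wave_in_trig odd_sums_base)
  qed
next
  case (Suc n)
  let ?R = "odd_sums (modes K \<epsilon>)"
  have "(\<lambda>x. \<phi> x * b x * b' x) \<in> trig ?R"
    if \<phi>: "\<phi> \<in> saturation K \<epsilon> n" and b: "b \<in> profiles K \<epsilon>" "b' \<in> profiles K \<epsilon>" for \<phi> b b'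
  proof -
    obtain k s l t where k: "k \<in> modes K \<epsilon>" "b = wave k s" and l: "l \<in> modes K \<epsilon>" "b' = wave l t"
      using profile_is_wave[OF b(1)] profile_is_wave[OF b(2)] by metis
    have "(\<lambda>x. \<phi> x * wave k s x * wave l t x) \<in> trig ((\<lambda>m. m + l) ` ((\<lambda>m. m + k) ` ?R \<union> (\<lambda>m. m - k) ` ?R)
        \<union> (\<lambda>m. m - l) ` ((\<lambda>m. m + k) ` ?R \<union> (\<lambda>m. m - k) ` ?R))"
      using Suc \<phi> by (intro trig_mult_wave) blast
    moreover have "m + k' + l' \<in> ?R" if "m \<in> ?R" "k' \<in> {k, - k}" "l' \<in> {l, - l}" for m k' l'
      by (rule odd_sums_step[OF that(1)]) (use that k l modes_uminus in auto)
    then have "(\<lambda>m. m + l) ` ((\<lambda>m. m + k) ` ?R \<union> (\<lambda>m. m - k) ` ?R)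
        \<union> (\<lambda>m. m - l) ` ((\<lambda>m. m + k) ` ?R \<union> (\<lambda>m. m - k) ` ?R) \<subseteq> ?R"
      by (force simp: diff_conv_add_uminus simp del: add_uminus_conv_diff)
    ultimately have "(\<lambda>x. \<phi> x * wave k s x * wave l t x) \<in> trig ?R"
      by (rule trig_mono[THEN subsetD, rotated])
    then show ?thesis by (simp add: k(2) l(2))
  qed
  then show ?case using Suc by auto
qed

lemma saturation_limit_eq_trig: "saturation_limit K \<epsilon> = trig (odd_sums (modes K \<epsilon>))"
proof
  show "saturation_limit K \<epsilon> \<subseteq> trig (odd_sums (modes K \<epsilon>))"
    unfolding saturation_limit_def trig_def
    by (rule fun_span_minimal) (use saturation_subset_trig in \<open>auto simp: trig_def\<close>)
  show "trig (odd_sums (modes K \<epsilon>)) \<subseteq> saturation_limit K \<epsilon>"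
    unfolding saturation_limit_def trig_def
    by (rule fun_span_minimal) (use wave_in_saturation_limit in \<open>auto simp: saturation_limit_def\<close>)
qed

lemma inner_wave_self_pos:
  assumes "k \<noteq> 0 \<or> s" shows "inner_torus (wave k s) (wave k s) > 0"
proof -
  have "k = - k \<longleftrightarrow> k = 0" by (auto simp: vec_eq_iff)
  then show ?thesis using assms torus_vol_pos by (simp add: inner_wave)
qed

text \<open>
A frequency \<open>n\<close> outside the odd sums is also not the negative of an odd sum, so the wave
\<open>cos (phase n x)\<close> is orthogonal to the saturation limit; its distance to every element is then at
least its own \<open>L\<^sup>2\<close>-norm, and the Sobolev norm is larger still.
\<close>

lemma saturating_iff_odd_sums: "saturating K \<epsilon> \<longleftrightarrow> odd_sums (modes K \<epsilon>) = UNIV"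
proof
  assume "odd_sums (modes K \<epsilon>) = UNIV"
  then show "saturating K \<epsilon>"
    unfolding saturating_def saturation_limit_eq_trig by (simp add: trig_dense_H1)
next
  let ?R = "odd_sums (modes K \<epsilon>)"
  assume sat: "saturating K \<epsilon>"
  have "n \<in> ?R" for n
  proof (rule ccontr)
    assume n: "n \<notin> ?R"
    let ?u = "wave n True"
    have pos: "inner_torus ?u ?u > 0" by (rule inner_wave_self_pos) simp
    have "?u \<in> H1_torus" by (rule trig_H1[of _ "{n}"]) (simp add: wave_in_trig)
    then obtain \<phi> where \<phi>: "\<phi> \<in> trig ?R" "H1_norm (\<lambda>x. ?u x - \<phi> x) < sqrt (inner_torus ?u ?u)"
      using sat pos unfolding saturating_def saturation_limit_eq_trig dense_in_H1_def
      by (meson real_sqrt_gt_zero)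
    have orth: "inner_torus ?u \<phi> = 0"
    proof (rule inner_torus_trig_zero[OF wave_L2 _ \<phi>(1)])
      fix k s assume "k \<in> ?R"
      then have "n \<noteq> k" "n \<noteq> - k" using n odd_sums_uminus by blast+
      then show "inner_torus ?u (wave k s) = 0" by (simp add: inner_wave)
    qed
    have "inner_torus ?u ?u \<le> inner_torus (\<lambda>x. ?u x - \<phi> x) (\<lambda>x. ?u x - \<phi> x)"
      using orth trig_L2[OF \<phi>(1)] inner_torus_self_nonneg[of \<phi>]
      by (simp add: inner_torus_diff_left inner_torus_diff_right L2_diff wave_L2 inner_torus_commute[of \<phi> ?u])
    also have "\<dots> \<le> (H1_norm (\<lambda>x. ?u x - \<phi> x))\<^sup>2" by (rule inner_torus_le_H1_norm)
    also have "\<dots> < inner_torus ?u ?u"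
    proof -
      have "0 \<le> H1_norm (\<lambda>x. ?u x - \<phi> x)"
        unfolding H1_norm_def by (auto intro!: add_nonneg_nonneg sum_nonneg)
      then show ?thesis using \<phi>(2) pos power_strict_mono[OF \<phi>(2), of 2] by simp
    qed
    finally show False by simp
  qed
  then show "?R = UNIV" by blast
qed

text \<open>
Waves with different labels are orthogonal and each has positive norm, so no two of them are the
same function.
\<close>

lemma card_profiles:
  assumes "fourier_mode_class K \<epsilon>" shows "card (profiles K \<epsilon>) = 2 * card K + \<epsilon>"
proof -
  have K: "finite K" "0 \<notin> K" "K \<inter> uminus ` K = {}" "\<epsilon> = 0 \<or> \<epsilon> = 1"
    using assms by (auto simp: fourier_mode_class_def)
  have not_minus: "k \<noteq> - l" if "k \<in> K" "l \<in> K" for k l using K that by auto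
  have inj: "inj_on (\<lambda>(k, s). wave k s) (K \<times> UNIV)"
  proof (rule inj_onI, clarify)
    fix k s l t assume kl: "k \<in> K" "l \<in> K" and eq: "wave k s = wave l t"
    have "inner_torus (wave k s) (wave l t) > 0"
      using inner_wave_self_pos[of k s] kl K by (auto simp: eq[symmetric])
    then show "k = l \<and> s = t"
      using not_minus[OF kl] by (auto simp: inner_wave of_bool_def split: if_splits)
  qed
  have waves: "(\<Union>k\<in>K. range (wave k)) = (\<lambda>(k, s). wave k s) ` (K \<times> UNIV)" by auto
  have card: "card (\<Union>k\<in>K. range (wave k)) = 2 * card K"
    unfolding waves card_image[OF inj] by (simp add: card_cartesian_product)
  have "wave 0 True \<noteq> wave k s" if "k \<in> K" for k s
  proof
    assume eq: "wave 0 True = wave k s"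
    have "inner_torus (wave 0 True) (wave k s) > 0"
      using inner_wave_self_pos[of 0 True] by (simp add: eq[symmetric])
    then show False using that K by (auto simp: inner_wave of_bool_def split: if_splits)
  qed
  then have "wave 0 True \<notin> (\<Union>k\<in>K. range (wave k))" by blast
  then show ?thesis
    unfolding profiles_eq_waves using K card by (auto simp: card_insert_if)
qed

section \<open>Parity counts and unimodular triples of wave vectors\<close>

text \<open>
Each mode has an odd sum of coefficients, except for the mode \<open>0\<close>, and an odd sum of modes has an odd
number of terms.
\<close>

lemma odd_sums_combination:
  assumes K: "finite K" "\<epsilon> \<in> {0, 1}" and n: "n \<in> odd_sums (modes K \<epsilon>)"
  obtains c where "n = (\<Sum>k\<in>K. c k *s k)" "\<epsilon> = 0 \<Longrightarrow> odd (\<Sum>k\<in>K. c k)"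
proof -
  define P where "P n c \<longleftrightarrow> n = (\<Sum>k\<in>K. c k *s k) \<and> (\<epsilon> = 0 \<longrightarrow> odd (\<Sum>k\<in>K. c k))" for n c
  have single: "(\<Sum>k\<in>K. (if k = l then a else 0) *s k) = a *s l" if "l \<in> K" for l :: "int^3" and a :: int
  proof -
    have "(\<Sum>k\<in>K. (if k = l then a else 0) *s k) = (\<Sum>k\<in>K. if k = l then a *s l else 0)"
      by (rule sum.cong) auto
    then show ?thesis using K that by simp
  qed
  have mode: "\<exists>c. P l c" if "l \<in> modes K \<epsilon>" for l
  proof -
    consider "l \<in> K" | "- l \<in> K" | "l = 0" "\<epsilon> = 1"
      using \<open>l \<in> modes K \<epsilon>\<close> by (auto simp: modes_def split: if_splits)
    then show ?thesis
    proof cases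
      case 1
      then show ?thesis
        by (intro exI[of _ "\<lambda>k. if k = l then 1 else 0"]) (use K in \<open>simp add: P_def single\<close>)
    next
      case 2
      have "(- 1) *s (- l) = l" by (simp add: vec_eq_iff)
      with 2 show ?thesis
        by (intro exI[of _ "\<lambda>k. if k = - l then - 1 else 0"])
           (use K in \<open>simp add: P_def single\<close>)
    next
      case 3
      then show ?thesis by (intro exI[of _ "\<lambda>k. 0"]) (simp add: P_def)
    qed
  qed
  have "\<exists>c. P n c"
    using n
  proof induction
    case (odd_sums_base k)
    then show ?case by (rule mode)
  next
    case (odd_sums_step n k l)
    obtain c d e where "P n c" "P k d" "P l e"
      using odd_sums_step.IH mode[OF odd_sums_step.hyps(2)] mode[OF odd_sums_step.hyps(3)] by blast
    then have "P (n + k + l) (\<lambda>i. c i + d i + e i)"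
      by (auto simp: P_def sum.distrib vec_eq_iff algebra_simps)
    then show ?case by blast
  qed
  then show ?thesis using that unfolding P_def by blast
qed

text \<open>
Modulo 2 an integer combination of \<open>K\<close> is the sum of the vectors with odd coefficient, and the number
of these has the parity of the sum of all coefficients. So the subsets on the right hit every one of
the eight parity classes of \<open>\<int>\<^sup>3\<close>.
\<close>

lemma parity_subsets_bound:
  fixes K :: "(int^3) set"
  assumes K: "finite K" and \<epsilon>: "\<epsilon> \<in> {0, 1 :: nat}"
    and comb: "\<And>n. \<exists>c. n = (\<Sum>k\<in>K. c k *s k) \<and> (\<epsilon> = 0 \<longrightarrow> odd (\<Sum>k\<in>K. c k))"
  shows "8 \<le> card {S. S \<subseteq> K \<and> (\<epsilon> = 0 \<longrightarrow> odd (card S))}"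
proof -
  let ?B = "{S. S \<subseteq> K \<and> (\<epsilon> = 0 \<longrightarrow> odd (card S))}"
  define par where "par S = (\<lambda>i. even (\<Sum>k\<in>S. k $ i))" for S :: "(int^3) set"
  have "UNIV \<subseteq> par ` ?B"
  proof
    fix v :: "3 \<Rightarrow> bool"
    obtain c where c: "(\<chi> i. if v i then 0 else 1) = (\<Sum>k\<in>K. c k *s k)"
      and odd: "\<epsilon> = 0 \<longrightarrow> odd (\<Sum>k\<in>K. c k)"
      using comb by blast
    define S where "S = {k \<in> K. odd (c k)}"
    have reduce: "even ((\<Sum>k\<in>K. c k * w k) - (\<Sum>k\<in>S. w k))" for w :: "int^3 \<Rightarrow> int"
    proof -
      have "(\<Sum>k\<in>S. w k) = (\<Sum>k\<in>K. if odd (c k) then w k else 0)"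
        using K by (simp add: S_def sum.inter_filter)
      then have "(\<Sum>k\<in>K. c k * w k) - (\<Sum>k\<in>S. w k) = (\<Sum>k\<in>K. c k * w k - (if odd (c k) then w k else 0))"
        by (simp add: sum_subtractf)
      also have "even \<dots>" by (rule dvd_sum) auto
      finally show ?thesis .
    qed
    have "par S i = v i" for i
    proof -
      have "(\<chi> i. if v i then 0 else 1) $ i = (\<Sum>k\<in>K. c k *s k) $ i" by (simp only: c)
      then have "(if v i then 0 else 1) = (\<Sum>k\<in>K. c k * k $ i)" by simp
      then show ?thesis using reduce[of "\<lambda>k. k $ i"] by (auto simp: par_def split: if_splits)
    qed
    moreover have "\<epsilon> = 0 \<longrightarrow> odd (card S)"
      using reduce[of "\<lambda>k. 1"] odd by auto
    ultimately show "v \<in> par ` ?B"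
      by (intro image_eqI[of _ _ S]) (auto simp: S_def)
  qed
  moreover have fin: "finite ?B" using K by simp
  ultimately have "card (UNIV :: (3 \<Rightarrow> bool) set) \<le> card ?B"
    by (meson card_image_le card_mono finite_imageI le_trans)
  then show ?thesis by (simp add: card_fun)
qed

text \<open>
A subset of \<open>K\<close> of odd cardinality is determined by its elements other than a fixed \<open>k0\<close>, so without
the constant profile only \<open>2 ^ (card K - 1)\<close> subsets are available for the eight parity classes; with
it there are \<open>2 ^ card K\<close>. The value \<open>\<epsilon>\<close> in the exponent covers both cases.
\<close>

lemma saturating_card_lower:
  assumes K: "fourier_mode_class K \<epsilon>" and sat: "saturating K \<epsilon>"
  shows "card K + \<epsilon> \<ge> 4"
proof -
  let ?B = "{S. S \<subseteq> K \<and> (\<epsilon> = 0 \<longrightarrow> odd (card S))}"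
  have fin: "finite K" "K \<noteq> {}" "\<epsilon> \<in> {0, 1}" using K by (auto simp: fourier_mode_class_def)
  have "\<exists>c. n = (\<Sum>k\<in>K. c k *s k) \<and> (\<epsilon> = 0 \<longrightarrow> odd (\<Sum>k\<in>K. c k))" for n
    using odd_sums_combination[OF fin(1,3), of n] sat unfolding saturating_iff_odd_sums by blast
  then have 8: "8 \<le> card ?B" using fin by (intro parity_subsets_bound) auto
  obtain k0 where k0: "k0 \<in> K" using fin by blast
  have "card ?B \<le> 2 ^ (card K - 1 + \<epsilon>)"
  proof (cases "\<epsilon> = 0")
    case True
    have removed: "even (card (S - {k0})) \<longleftrightarrow> k0 \<in> S" if "S \<in> ?B" for S
    proof (cases "k0 \<in> S")
      case in_S: True
      then have "card S = Suc (card (S - {k0}))"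
        using that fin finite_subset by (intro card.remove) auto
      then show ?thesis using that True in_S by auto
    next
      case False
      then show ?thesis using that \<open>\<epsilon> = 0\<close> by auto
    qed
    have "inj_on (\<lambda>S. S - {k0}) ?B"
    proof (rule inj_onI)
      fix S S' assume S: "S \<in> ?B" "S' \<in> ?B" and eq: "S - {k0} = S' - {k0}"
      have "k0 \<in> S \<longleftrightarrow> k0 \<in> S'"
        using removed[OF S(1)] removed[OF S(2)] by (simp only: eq)
      then show "S = S'" using eq by blast
    qed
    then have "card ?B = card ((\<lambda>S. S - {k0}) ` ?B)" by (simp add: card_image)
    also have "\<dots> \<le> card (Pow (K - {k0}))"
      using fin by (intro card_mono) auto
    also have "\<dots> = 2 ^ (card K - 1)" using fin k0 by (simp add: card_Pow)
    finally show ?thesis using True by simp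
  next
    case False
    then have "\<epsilon> = 1" "?B = Pow K" using fin by auto
    moreover have "card K > 0" using fin by (simp add: card_gt_0_iff)
    ultimately show ?thesis using fin by (simp add: card_Pow)
  qed
  then have "(2::nat) ^ 3 \<le> 2 ^ (card K - 1 + \<epsilon>)" using 8 by simp
  then have "3 \<le> card K - 1 + \<epsilon>" by (rule power_le_imp_le_exp[rotated]) simp
  moreover have "card K > 0" using fin by (simp add: card_gt_0_iff)
  ultimately show ?thesis by linarith
qed

text \<open>
The coefficients that express the coordinate vectors through \<open>K\<close> form an integer inverse of the
matrix with rows \<open>K\<close>, so its determinant is a unit.
\<close>

lemma unimodular_basis_if_saturating:
  assumes K: "fourier_mode_class K \<epsilon>" "saturating K \<epsilon>" and "card K = 3"
  shows "unimodular_basis K"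
proof -
  obtain a b c where abc: "K = {a, b, c}" "a \<noteq> b" "b \<noteq> c" "a \<noteq> c"
    using \<open>card K = 3\<close> unfolding card_3_iff by blast
  have fin: "finite K" "\<epsilon> \<in> {0, 1}" using K by (auto simp: fourier_mode_class_def)
  have "\<exists>f. n = f a *s a + f b *s b + f c *s c" for n
  proof -
    obtain f where "n = (\<Sum>k\<in>K. f k *s k)"
      using odd_sums_combination[OF fin, of n] K(2) unfolding saturating_iff_odd_sums by blast
    then have "n = f a *s a + f b *s b + f c *s c" using abc by (simp add: add.assoc)
    then show ?thesis by blast
  qed
  then have "\<forall>i. \<exists>f. (axis i 1 :: int^3) = f a *s a + f b *s b + f c *s c" by blast
  then have "\<exists>f. \<forall>i. (axis i 1 :: int^3) = f i a *s a + f i b *s b + f i c *s c" by (rule choice)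
  then obtain f where f: "(axis i 1 :: int^3) = f i a *s a + f i b *s b + f i c *s c" for i by blast
  define C :: "int^3^3" where "C = (\<chi> i. vector [f i a, f i b, f i c])"
  let ?M = "vector [a, b, c] :: int^3^3"
  have "C ** ?M = mat 1"
  proof -
    have "(C ** ?M) $ i $ j = (f i a *s a + f i b *s b + f i c *s c) $ j" for i j
      by (simp add: C_def matrix_matrix_mult_def sum_3 vector_3)
    then have "(C ** ?M) $ i $ j = (axis i 1 :: int^3) $ j" for i j by (simp add: f)
    then show ?thesis by (simp add: vec_eq_iff mat_def axis_def eq_commute)
  qed
  then have "det C * det ?M = 1" by (metis det_mul det_I)
  then have "\<bar>det ?M * det C\<bar> = 1" by (simp add: mult.commute)
  then have "\<bar>det ?M\<bar> = 1" by (rule abs_zmult_eq_1)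
  then show ?thesis
    unfolding unimodular_basis_def using abc(1) by blast
qed

text \<open>
Cramer's rule; the determinant is its own inverse.
\<close>

lemma unimodular_combination:
  assumes "\<bar>det (vector [a, b, c] :: int^3^3)\<bar> = 1"
  obtains x y z :: int where "n = x *s a + y *s b + z *s c"
proof -
  define D where "D = det (vector [a, b, c] :: int^3^3)"
  have "D * D = 1" using assms by (auto simp: D_def abs_if split: if_splits)
  define x y z where "x = det (vector [n, b, c] :: int^3^3)" and "y = det (vector [a, n, c] :: int^3^3)"
    and "z = det (vector [a, b, n] :: int^3^3)"
  have "D * n $ j = x * a $ j + y * b $ j + z * c $ j" for j
  proof -
    have "\<forall>j. D * n $ j = x * a $ j + y * b $ j + z * c $ j"
      unfolding forall_3 D_def x_def y_def z_def det_3 vector_3 by (simp add: algebra_simps)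
    then show ?thesis by blast
  qed
  then have "D * (D * n $ j) = D * (x * a $ j + y * b $ j + z * c $ j)" for j by simp
  then have "(D * D) * n $ j = D * x * a $ j + D * y * b $ j + D * z * c $ j" for j
    by (simp add: algebra_simps)
  then have "n = (D * x) *s a + (D * y) *s b + (D * z) *s c"
    using \<open>D * D = 1\<close> by (simp add: vec_eq_iff)
  then show ?thesis by (rule that)
qed

text \<open>
Adding the triple \<open>p + q + r = 0\<close> changes the parity of the number of summands but not the sum, so the
odd sums are closed under adding a single mode. They contain \<open>0\<close>, hence all integer combinations of
\<open>a\<close>, \<open>b\<close> and \<open>c\<close>.
\<close>

lemma saturating_if_zero_triple:
  assumes zero: "p \<in> modes K \<epsilon>" "q \<in> modes K \<epsilon>" "r \<in> modes K \<epsilon>" "p + q + r = 0"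
    and basis: "a \<in> modes K \<epsilon>" "b \<in> modes K \<epsilon>" "c \<in> modes K \<epsilon>"
      "\<bar>det (vector [a, b, c] :: int^3^3)\<bar> = 1"
  shows "saturating K \<epsilon>"
proof -
  let ?R = "odd_sums (modes K \<epsilon>)"
  have "p + q + r \<in> ?R" using zero by (intro odd_sums_step odd_sums_base)
  then have 0: "0 \<in> ?R" using zero by simp
  have step: "n + k \<in> ?R" if n: "n \<in> ?R" and k: "k \<in> modes K \<epsilon>" for n k
  proof -
    \<comment> \<open>Four summands are added to \<open>n\<close>, so that two steps of \<open>odd_sums\<close> lead to \<open>n + k\<close>.\<close>
    have "(n + k + p) + q + r \<in> ?R"
      using odd_sums_step[OF odd_sums_step[OF n k zero(1)] zero(2,3)] .
    moreover have "(n + k + p) + q + r = (n + k) + (p + q + r)" by (simp only: add.assoc)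
    ultimately show ?thesis using zero by simp
  qed
  have mult: "n + x *s k \<in> ?R" if n: "n \<in> ?R" and k: "k \<in> modes K \<epsilon>" for n k and x :: int
  proof (induction x rule: int_induct[where k = 0])
    case base
    then show ?case using n by (simp add: vector_smult_lzero)
  next
    case (step1 i)
    have eq: "n + i *s k + k = n + (i + 1) *s k" by (simp add: vec_eq_iff algebra_simps)
    show ?case using step[OF step1(2) k] by (simp only: eq)
  next
    case (step2 i)
    have eq: "n + i *s k + - k = n + (i - 1) *s k" by (simp add: vec_eq_iff algebra_simps)
    show ?case using step[OF step2(2) modes_uminus[OF k]] by (simp only: eq)
  qed
  have "n \<in> ?R" for n
  proof -
    obtain x y z where n: "n = x *s a + y *s b + z *s c"
      using unimodular_combination[OF basis(4)] by blast
    have "0 + x *s a + y *s b + z *s c \<in> ?R" using 0 basis by (intro mult)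
    then show ?thesis by (simp add: n)
  qed
  then show ?thesis unfolding saturating_iff_odd_sums by blast
qed

section \<open>The coordinate forcings\<close>

lemma axes_distinct:
  "(e\<^sub>1 = e\<^sub>2) = False" "(e\<^sub>1 = e\<^sub>3) = False" "(e\<^sub>2 = e\<^sub>3) = False"
  by (simp_all add: axis_eq_axis)

lemma det_axes: "det (vector [e\<^sub>1, e\<^sub>2, e\<^sub>3] :: int^3^3) = 1"
  by (simp add: det_3 vector_3 axis_def)

text \<open>
If the coordinate sum is positive on \<open>K\<close>, then it is negative on \<open>- K\<close>, so the two sets are disjoint.
\<close>

lemma fourier_mode_class_if_positive:
  assumes "finite K" "K \<noteq> {}" "\<epsilon> \<in> {0, 1}" and pos: "\<And>k. k \<in> K \<Longrightarrow> 0 < k $ 1 + k $ 2 + k $ 3"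
  shows "fourier_mode_class K \<epsilon>"
proof -
  have "- k \<notin> K" if "k \<in> K" for k using pos[OF that] pos[of "- k"] by fastforce
  moreover have "0 \<notin> K" using pos[of 0] by auto
  ultimately show ?thesis using assms(1-3) unfolding fourier_mode_class_def by auto
qed

lemma fourier_mode_class_axes_sum: "fourier_mode_class {e\<^sub>1, e\<^sub>2, e\<^sub>3, e\<^sub>1 + e\<^sub>2} 0"
proof (rule fourier_mode_class_if_positive)
  fix k assume k: "k \<in> {e\<^sub>1, e\<^sub>2, e\<^sub>3, e\<^sub>1 + e\<^sub>2}"
  have "0 < e $ 1 + e $ 2 + e $ 3" if "e = e\<^sub>1 \<or> e = e\<^sub>2 \<or> e = e\<^sub>3 \<or> e = e\<^sub>1 + e\<^sub>2" for e
    using that by (elim disjE) (simp_all add: axis_def)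
  with k show "0 < k $ 1 + k $ 2 + k $ 3" by blast
qed simp_all

lemma fourier_mode_class_axes:
  assumes "\<epsilon> \<in> {0, 1}" shows "fourier_mode_class {e\<^sub>1, e\<^sub>2, e\<^sub>3} \<epsilon>"
proof -
  have "{e\<^sub>1, e\<^sub>2, e\<^sub>3} \<inter> uminus ` {e\<^sub>1, e\<^sub>2, e\<^sub>3} = {}" "0 \<notin> {e\<^sub>1, e\<^sub>2, e\<^sub>3}"
    using fourier_mode_class_axes_sum unfolding fourier_mode_class_def by blast+
  with assms show ?thesis unfolding fourier_mode_class_def by simp
qed

lemma card_axes: "card {e\<^sub>1, e\<^sub>2, e\<^sub>3} = 3"
  by (simp add: axes_distinct)

lemma card_axes_sum: "card {e\<^sub>1, e\<^sub>2, e\<^sub>3, e\<^sub>1 + e\<^sub>2} = 4"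
proof -
  have "e\<^sub>1 + e\<^sub>2 \<notin> {e\<^sub>1, e\<^sub>2, e\<^sub>3}" by (auto simp: vec_eq_iff forall_3 axis_def)
  then have "card (insert (e\<^sub>1 + e\<^sub>2) {e\<^sub>1, e\<^sub>2, e\<^sub>3}) = 4" by (subst card_insert_disjoint) (auto simp: card_axes)
  moreover have "{e\<^sub>1, e\<^sub>2, e\<^sub>3, e\<^sub>1 + e\<^sub>2} = insert (e\<^sub>1 + e\<^sub>2) {e\<^sub>1, e\<^sub>2, e\<^sub>3}" by auto
  ultimately show ?thesis by simp
qed

lemma saturating_axes_sum: "saturating {e\<^sub>1, e\<^sub>2, e\<^sub>3, e\<^sub>1 + e\<^sub>2} 0"
proof -
  let ?A = "modes {e\<^sub>1, e\<^sub>2, e\<^sub>3, e\<^sub>1 + e\<^sub>2} 0"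
  have A: "e\<^sub>1 \<in> ?A" "e\<^sub>2 \<in> ?A" "e\<^sub>3 \<in> ?A" "- (e\<^sub>1 + e\<^sub>2) \<in> ?A"
    unfolding modes_def by blast+
  show ?thesis
    by (rule saturating_if_zero_triple[OF A(1,2,4) _ A(1-3)]) (simp_all add: det_axes)
qed

lemma saturating_if_unimodular:
  assumes "unimodular_basis K" shows "saturating K 1"
proof -
  obtain a b c where "K = {a, b, c}" "\<bar>det (vector [a, b, c] :: int^3^3)\<bar> = 1"
    using assms unfolding unimodular_basis_def by blast
  then show ?thesis
    by (intro saturating_if_zero_triple[of 0 _ _ 0 0 a b c]) (auto simp: modes_def)
qed

text \<open>
A sum of two signed unit vectors has even coordinate sum. Conversely, the vectors \<open>e\<^sub>1 - e\<^sub>3\<close>,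
\<open>e\<^sub>2 - e\<^sub>3\<close> and \<open>2 e\<^sub>3\<close> are such sums and form a basis of the sublattice of even coordinate sum.
\<close>

lemma Gamma_pair_axes:
  "Gamma_pair {e\<^sub>1, e\<^sub>2, e\<^sub>3} 0 = {n. even (n $ 1 + n $ 2 + n $ 3)}" (is "_ = ?E")
proof
  let ?A = "modes {e\<^sub>1, e\<^sub>2, e\<^sub>3} 0"
  let ?G = "{k + k' | k k'. k \<in> ?A \<and> k' \<in> ?A}"
  have odd: "odd (k $ 1 + k $ 2 + k $ 3)" if "k \<in> ?A" for k
    using that by (auto simp: modes_def axis_def)
  show "Gamma_pair {e\<^sub>1, e\<^sub>2, e\<^sub>3} 0 \<subseteq> ?E"
    unfolding Gamma_pair_def
  proof (rule int_vec.span_minimal)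
    show "?G \<subseteq> ?E"
    proof clarify
      fix k k' assume "k \<in> ?A" "k' \<in> ?A"
      then have "even ((k $ 1 + k $ 2 + k $ 3) + (k' $ 1 + k' $ 2 + k' $ 3))"
        using odd by simp
      then show "even ((k + k') $ 1 + (k + k') $ 2 + (k + k') $ 3)" by (simp add: algebra_simps)
    qed
    have "even ((x + y) $ 1 + (x + y) $ 2 + (x + y) $ 3)"
      if "even (x $ 1 + x $ 2 + x $ 3)" "even (y $ 1 + y $ 2 + y $ 3)" for x y :: "int^3"
      using dvd_add[OF that] by (simp add: algebra_simps)
    moreover have "even ((c *s x) $ 1 + (c *s x) $ 2 + (c *s x) $ 3)"
      if "even (x $ 1 + x $ 2 + x $ 3)" for x :: "int^3" and c
      using dvd_mult[OF that, of c] by (simp add: algebra_simps)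
    ultimately show "int_vec.subspace ?E"
      unfolding int_vec.subspace_def by auto
  qed
  show "?E \<subseteq> Gamma_pair {e\<^sub>1, e\<^sub>2, e\<^sub>3} 0"
  proof
    fix n assume "n \<in> ?E"
    then have "even (n $ 1 + n $ 2 + n $ 3)" by (simp only: mem_Collect_eq)
    then obtain m where m: "n $ 1 + n $ 2 + n $ 3 = 2 * m" by (rule evenE)
    have n: "n = (n $ 1) *s (e\<^sub>1 + - e\<^sub>3) + (n $ 2) *s (e\<^sub>2 + - e\<^sub>3) + m *s (e\<^sub>3 + e\<^sub>3)"
      using m by (simp add: vec_eq_iff forall_3 axis_def)
    have "e\<^sub>1 + - e\<^sub>3 \<in> ?G" "e\<^sub>2 + - e\<^sub>3 \<in> ?G" "e\<^sub>3 + e\<^sub>3 \<in> ?G"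
      unfolding mem_Collect_eq modes_def by blast+
    then show "n \<in> Gamma_pair {e\<^sub>1, e\<^sub>2, e\<^sub>3} 0"
      unfolding Gamma_pair_def
      by (subst n) (intro int_vec.span_add int_vec.span_scale int_vec.span_base)
  qed
qed

lemma lattice_index_Gamma_pair_axes: "lattice_index (Gamma_pair {e\<^sub>1, e\<^sub>2, e\<^sub>3} 0) = 2"
proof -
  define s where "s n = n $ 1 + n $ 2 + n $ 3" for n :: "int^3"
  define r where "r = {(x :: int^3, y). even (s y - s x)}"
  have "Gamma_pair {e\<^sub>1, e\<^sub>2, e\<^sub>3} 0 = {n. even (s n)}"
    by (simp only: Gamma_pair_axes s_def)
  moreover have "s (y - x) = s y - s x" for x y by (simp add: s_def)
  ultimately have "{(x, y). y - x \<in> Gamma_pair {e\<^sub>1, e\<^sub>2, e\<^sub>3} 0} = r"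
    by (simp only: r_def mem_Collect_eq)
  moreover have "UNIV // r = {{y. even (s y)}, {y. odd (s y)}}"
  proof -
    have "r `` {x} = (if even (s x) then {y. even (s y)} else {y. odd (s y)})" for x
      by (auto simp: r_def)
    moreover have "even (s 0)" "odd (s e\<^sub>1)" by (simp_all add: s_def axis_def)
    ultimately show ?thesis unfolding quotient_def by (auto split: if_splits)
  qed
  moreover have "{y. even (s y)} \<noteq> {y. odd (s y)}" by blast
  ultimately show ?thesis by (simp add: lattice_index_def)
qed

theorem corollary4p21:
  shows
    "((\<forall>K. fourier_mode_class K 1 \<and> saturating K 1 \<longrightarrow> 7 \<le> card (profiles K 1)) \<and>
      (\<forall>K. fourier_mode_class K 1 \<longrightarrow>
         (saturating K 1 \<and> card (profiles K 1) = 7 \<longleftrightarrow> card K = 3 \<and> unimodular_basis K)) \<and>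
      fourier_mode_class {e\<^sub>1, e\<^sub>2, e\<^sub>3} 1 \<and>
      saturating {e\<^sub>1, e\<^sub>2, e\<^sub>3} 1 \<and>
      profiles {e\<^sub>1, e\<^sub>2, e\<^sub>3} 1 =
        {\<lambda>x. 1} \<union> (\<Union>i. {\<lambda>x. cos (x $ i), \<lambda>x. sin (x $ i)}) \<and>
      card (profiles {e\<^sub>1, e\<^sub>2, e\<^sub>3} 1) = 7)
     \<and>
     ((\<forall>K. fourier_mode_class K 0 \<and> saturating K 0 \<longrightarrow>
         4 \<le> card K \<and> 8 \<le> card (profiles K 0)) \<and>
      fourier_mode_class {e\<^sub>1, e\<^sub>2, e\<^sub>3, e\<^sub>1 + e\<^sub>2} 0 \<and>
      saturating {e\<^sub>1, e\<^sub>2, e\<^sub>3, e\<^sub>1 + e\<^sub>2} 0 \<and>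
      card {e\<^sub>1, e\<^sub>2, e\<^sub>3, e\<^sub>1 + e\<^sub>2} = 4 \<and>
      card (profiles {e\<^sub>1, e\<^sub>2, e\<^sub>3, e\<^sub>1 + e\<^sub>2} 0) = 8)
     \<and>
     (fourier_mode_class {e\<^sub>1, e\<^sub>2, e\<^sub>3} 0 \<and>
      \<not> saturating {e\<^sub>1, e\<^sub>2, e\<^sub>3} 0 \<and>
      Gamma_pair {e\<^sub>1, e\<^sub>2, e\<^sub>3} 0 = {n. even (n $ 1 + n $ 2 + n $ 3)} \<and>
      lattice_index (Gamma_pair {e\<^sub>1, e\<^sub>2, e\<^sub>3} 0) = 2)"
proof (intro conjI allI impI)
  let ?E = "{e\<^sub>1, e\<^sub>2, e\<^sub>3}" and ?E' = "{e\<^sub>1, e\<^sub>2, e\<^sub>3, e\<^sub>1 + e\<^sub>2}"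
  have unimodular: "unimodular_basis ?E"
    unfolding unimodular_basis_def using det_axes by (intro exI[of _ e\<^sub>1] exI[of _ e\<^sub>2] exI[of _ e\<^sub>3]) simp
  show "7 \<le> card (profiles K 1)" if "fourier_mode_class K 1 \<and> saturating K 1" for K
    using that saturating_card_lower[of K 1] card_profiles[of K 1] by simp
  show "saturating K 1 \<and> card (profiles K 1) = 7 \<longleftrightarrow> card K = 3 \<and> unimodular_basis K"
    if "fourier_mode_class K 1" for K
    using card_profiles[OF that] unimodular_basis_if_saturating[OF that] saturating_if_unimodular[of K] by auto
  show E1: "fourier_mode_class ?E 1" by (simp add: fourier_mode_class_axes)
  show "saturating ?E 1" using unimodular by (rule saturating_if_unimodular)
  show "profiles ?E 1 = {\<lambda>x. 1} \<union> (\<Union>i. {\<lambda>x. cos (x $ i), \<lambda>x. sin (x $ i)})"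
    by (simp add: profiles_def phase_axis UNIV_3)
  show "card (profiles ?E 1) = 7" using card_profiles[OF E1] card_axes by simp
  show "4 \<le> card K" "8 \<le> card (profiles K 0)" if "fourier_mode_class K 0 \<and> saturating K 0" for K
    using that saturating_card_lower[of K 0] card_profiles[of K 0] by simp_all
  show "fourier_mode_class ?E' 0" by (rule fourier_mode_class_axes_sum)
  show "saturating ?E' 0" by (rule saturating_axes_sum)
  show "card ?E' = 4" by (rule card_axes_sum)
  show "card (profiles ?E' 0) = 8"
    using card_profiles[OF fourier_mode_class_axes_sum] card_axes_sum by simp
  show E0: "fourier_mode_class ?E 0" by (simp add: fourier_mode_class_axes)
  show "\<not> saturating ?E 0" using saturating_card_lower[OF E0] card_axes by auto
  show "Gamma_pair ?E 0 = {n. even (n $ 1 + n $ 2 + n $ 3)}" by (rule Gamma_pair_axes)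
  show "lattice_index (Gamma_pair ?E 0) = 2" by (rule lattice_index_Gamma_pair_axes)
qed

end
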